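(* Let $k$ be a field and let $V$ be a $k$-vector space. Let $\mathcal{T}(V)$ be the set of all pairs $(\lambda, \Lambda) \in \mathrm{End}_k(V) \times \mathrm{End}_k(V)$ satisfying $\lambda^2 = \Lambda^2 = 0$ and $\Lambda \circ \lambda = \lambda \circ \Lambda$. Then: (1) There exists a bijection $$\mathrm{Met}(k, V) \cong \{ (\lambda, \Lambda, \zeta) \in \mathcal{T}(V) \times V \mid \zeta \in \mathrm{Ker}(\Lambda - \lambda) \}$$ such that the metabelian datum $(k, V, \triangleleft, \triangleright, \theta)$ of $k$ by $V$ associated to a triple $(\lambda, \Lambda, \zeta)$ is given, for all $x \in V$ and $p, q \in k$, by $$x \triangleleft p := p\, \lambda(x), \qquad p \triangleright x := p\, \Lambda(x), \qquad \theta(p, q) := pq\, \zeta.$$ (2) There exists a bijection $$\mathrm{Ext}(k_0, V_0) \ \cong \ \bigsqcup_{(\lambda, \Lambda) \in \mathcal{T}(V)} \mathrm{Ker}(\Lambda - \lambda)/\mathrm{Im}(\Lambda + \lambda)$$ that (from right to left) sends an element $\overline{\zeta} \in \mathrm{Ker}(\Lambda - \lambda)/\mathrm{Im}(\Lambda + \lambda)$ to (the class of the extension given by) the metabelian product $k \star_{(\lambda, \Lambda, \zeta)} V = k \times V$ with the multiplication $$(p, x) \star (q, y) = (0, \ pq\, \zeta + p\, \Lambda(y) + q\, \lambda(x)), \qquad p, q \in k, \ x, y \in V.$$ (3) Any metabelian $k$-algebra having derived algebra of codimension $1$ is isomorphic to an algebra $k \star_{(\lambda, \Lambda, \zeta)}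 W$ for some vector space $W$, some $(\lambda, \Lambda) \in \mathcal{T}(W)$ and some $\zeta \in \mathrm{Ker}(\Lambda - \lambda)$.
   Context: All vector spaces, algebras, linear and bilinear maps are over an arbitrary field $k$; algebras are associative, not necessarily unital. For a vector space $V$, $V_0$ denotes $V$ with the trivial multiplication $xy = 0$ (an "abelian" algebra). The derived algebra of an algebra $A$ is the linear span of all products $xy$, $x, y \in A$. A metabelian datum of a vector space $P$ by a vector space $V$ is a system $(P, V, \triangleleft, \triangleright, \theta)$ of bilinear maps $\triangleleft : V \times P \to V$, $\triangleright : P \times V \to V$, $\theta : P \times P \to V$ such that for all $p, q, r \in P$ and $x \in V$: $$(x \triangleleft p) \triangleleft q = p \triangleright (q \triangleright x) = 0, \quad p \triangleright (x \triangleleft q) = (p \triangleright x) \triangleleft q, \quad p \triangleright \theta(q, r) = \theta(p, q) \triangleleft r.$$ $\mathrm{Met}(P, V)$ is the set of all metabelian data of $P$ by $V$. The metabelian product associated to such a datum is the algebra $P \times V$ with multiplication $(p, x) \star (q, y) = (0, \theta(p, q) + p \triangleright y + x \triangleleft q)$; it is an extension of $P_0$ by $V_0$ via $x \mapsto (0, x)$ and $(p, x) \mapsto p$. An extension of an algebra $Q$ by an algebra $W$ is a triple $(A, i, \pi)$ with $i : W \to A$, $\pi : A \to Q$ algebra morphisms such that $0 \to W \xrightarrow{i} A \xrightarrow{\pi} Q \to 0$ is exact. Two extensions $(A, i, \pi)$, $(B, j, \rho)$ of $Q$ by $W$ are equivalent if there is an algebra morphism $\varphi : A \to B$ with $\varphi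 \circ i = j$ and $\rho \circ \varphi = \pi$; $\mathrm{Ext}(Q, W)$ is the set of equivalence classes. An algebra is metabelian if it is an extension of an abelian algebra by an abelian algebra. For $(\lambda, \Lambda) \in \mathcal{T}(V)$ one has $\mathrm{Im}(\Lambda + \lambda) \subseteq \mathrm{Ker}(\Lambda - \lambda)$, so the quotient vector space in (2) is defined; $\overline{\zeta}$ denotes the class of $\zeta \in \mathrm{Ker}(\Lambda - \lambda)$ in this quotient. *)

theory Defs
  imports "HOL-Algebra.AbelCoset" "Jordan_Normal_Form.Missing_VectorSpace"
begin

text \<open>
  Vector spaces are those of the locale \<open>vectorspace\<close>: a field \<open>K\<close> and a module record over it.
  The record type also has a multiplication, which is used to carry algebra structures;
  its unit field is never looked at, so algebras need not be unital.
\<close>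

definition bilinear_map ::
  "('k, 'r) ring_scheme \<Rightarrow> ('k, 'a) module \<Rightarrow> ('k, 'b) module \<Rightarrow> ('k, 'c) module
    \<Rightarrow> ('a \<times> 'b \<Rightarrow> 'c) \<Rightarrow> bool" where
  "bilinear_map K X Y Z f \<longleftrightarrow>
     (\<forall>y \<in> carrier Y. (\<lambda>x. f (x, y)) \<in> module_hom K X Z) \<and>
     (\<forall>x \<in> carrier X. (\<lambda>y. f (x, y)) \<in> module_hom K Y Z)"

locale assoc_algebra = vectorspace K A
  for K :: "('k, 'r) ring_scheme" and A :: "('k, 'a) module" +
  assumes mult_bilinear: "bilinear_map K A A A (\<lambda>(x, y). x \<otimes>\<^bsub>A\<^esub> y)"
    and mult_assoc: "\<lbrakk>x \<in> carrier A; y \<in> carrier A; z \<in> carrier A\<rbrakk>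
      \<Longrightarrow> (x \<otimes>\<^bsub>A\<^esub> y) \<otimes>\<^bsub>A\<^esub> z = x \<otimes>\<^bsub>A\<^esub> (y \<otimes>\<^bsub>A\<^esub> z)"

definition abelian_alg :: "('k, 'a) module \<Rightarrow> bool" where
  "abelian_alg A \<longleftrightarrow> (\<forall>x \<in> carrier A. \<forall>y \<in> carrier A. x \<otimes>\<^bsub>A\<^esub> y = \<zero>\<^bsub>A\<^esub>)"

definition trivial_alg :: "('k, 'a) module \<Rightarrow> ('k, 'a) module" where
  "trivial_alg V = V\<lparr>mult := \<lambda>x y. \<zero>\<^bsub>V\<^esub>\<rparr>"

definition self_space :: "('k, 'r) ring_scheme \<Rightarrow> ('k, 'k) module" where
  "self_space K = \<lparr>carrier = carrier K, mult = mult K, one = one K, zero = zero K,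
     add = add K, smult = mult K\<rparr>"

definition alg_hom ::
  "('k, 'r) ring_scheme \<Rightarrow> ('k, 'a) module \<Rightarrow> ('k, 'b) module \<Rightarrow> ('a \<Rightarrow> 'b) set" where
  "alg_hom K A B = {f \<in> module_hom K A B.
     \<forall>x \<in> carrier A. \<forall>y \<in> carrier A. f (x \<otimes>\<^bsub>A\<^esub> y) = f x \<otimes>\<^bsub>B\<^esub> f y}"

definition alg_isomorphic ::
  "('k, 'r) ring_scheme \<Rightarrow> ('k, 'a) module \<Rightarrow> ('k, 'b) module \<Rightarrow> bool" where
  "alg_isomorphic K A B \<longleftrightarrow> (\<exists>f \<in> alg_hom K A B. bij_betw f (carrier A) (carrier B))"

definition derived_alg :: "('k, 'r) ring_scheme \<Rightarrow> ('k, 'a) module \<Rightarrow> 'a set" where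
  "derived_alg K A = module.span K A {x \<otimes>\<^bsub>A\<^esub> y | x y. x \<in> carrier A \<and> y \<in> carrier A}"

definition quot_space :: "('k, 'a) module \<Rightarrow> 'a set \<Rightarrow> ('k, 'a set) module" where
  "quot_space V U = \<lparr>carrier = a_rcosets\<^bsub>V\<^esub> U, mult = (\<lambda>X Y. U), one = U, zero = U,
     add = set_add V, smult = (\<lambda>c X. \<Union>x\<in>X. U +>\<^bsub>V\<^esub> (c \<odot>\<^bsub>V\<^esub> x))\<rparr>"

lemma quot_space_vectorspace:
  assumes "subspace K U V" shows "vectorspace K (quot_space V U)"
proof -
  interpret V: vectorspace K V using assms by (simp add: subspace_def)
  have sm: "submodule K U V" using assms by (simp add: subspace_def)
  interpret U: submodule K U V by fact
  have inv: "\<ominus>\<^bsub>V\<^esub> u \<in> U" if "u \<in> U" for u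
  proof -
    have u: "u \<in> carrier V" using that U.subset by blast
    have "(\<ominus>\<^bsub>K\<^esub> \<one>\<^bsub>K\<^esub>) \<odot>\<^bsub>V\<^esub> u \<in> U" using that by (intro U.smult_closed) auto
    moreover have "(\<ominus>\<^bsub>K\<^esub> \<one>\<^bsub>K\<^esub>) \<odot>\<^bsub>V\<^esub> u = \<ominus>\<^bsub>V\<^esub> (\<one>\<^bsub>K\<^esub> \<odot>\<^bsub>V\<^esub> u)" using u by (intro V.smult_l_minus) auto
    ultimately show ?thesis using u by simp
  qed
  have "additive_subgroup U V"
    by (intro additive_subgroup.intro V.M.add.subgroupI)
       (use U.subset U.zero_closed inv in \<open>force simp: a_inv_def\<close>)+
  then interpret U: abelian_subgroup U V
    by (rule abelian_subgroupI3) (rule V.M.abelian_group_axioms)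
  have add: "(U +>\<^bsub>V\<^esub> x) <+>\<^bsub>V\<^esub> (U +>\<^bsub>V\<^esub> y) = U +>\<^bsub>V\<^esub> (x \<oplus>\<^bsub>V\<^esub> y)"
    if "x \<in> carrier V" "y \<in> carrier V" for x y
    using U.a_rcos_sum that by blast
  have cos: "U +>\<^bsub>V\<^esub> y = U +>\<^bsub>V\<^esub> x" if "y \<in> U +>\<^bsub>V\<^esub> x" "x \<in> carrier V" for x y
    using V.M.a_repr_independence[OF that U.a_subgroup] by simp 
  have sm: "(\<Union>y\<in>U +>\<^bsub>V\<^esub> x. U +>\<^bsub>V\<^esub> (c \<odot>\<^bsub>V\<^esub> y)) = U +>\<^bsub>V\<^esub> (c \<odot>\<^bsub>V\<^esub> x)"
    if x: "x \<in> carrier V" and c: "c \<in> carrier K" for c x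
  proof -
    have "U +>\<^bsub>V\<^esub> (c \<odot>\<^bsub>V\<^esub> y) = U +>\<^bsub>V\<^esub> (c \<odot>\<^bsub>V\<^esub> x)" if y: "y \<in> U +>\<^bsub>V\<^esub> x" for y
    proof -
      obtain u where u: "u \<in> U" "y = u \<oplus>\<^bsub>V\<^esub> x" using y by (auto simp: a_r_coset_def')
      then have "c \<odot>\<^bsub>V\<^esub> y = c \<odot>\<^bsub>V\<^esub> u \<oplus>\<^bsub>V\<^esub> c \<odot>\<^bsub>V\<^esub> x"
        using x c U.subset by (auto intro!: V.smult_r_distr)
      moreover have "c \<odot>\<^bsub>V\<^esub> u \<in> U" using u c by blast
      ultimately have "c \<odot>\<^bsub>V\<^esub> y \<in> U +>\<^bsub>V\<^esub> (c \<odot>\<^bsub>V\<^esub> x)" by (auto simp: a_r_coset_def')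
      then show ?thesis using cos x c by blast
    qed
    moreover have "x \<in> U +>\<^bsub>V\<^esub> x" using x U.zero_closed by (force simp: a_r_coset_def')
    ultimately show ?thesis by blast
  qed
  have car: "X \<in> a_rcosets\<^bsub>V\<^esub> U \<longleftrightarrow> (\<exists>x\<in>carrier V. X = U +>\<^bsub>V\<^esub> x)" for X
    by (auto simp: A_RCOSETS_def' a_r_coset_def')
  have U0: "U +>\<^bsub>V\<^esub> \<zero>\<^bsub>V\<^esub> = U" using V.M.a_coset_add_zero U.subset by auto
  have ab: "abelian_group (quot_space V U)"
  proof (rule abelian_groupI)
    show "\<zero>\<^bsub>quot_space V U\<^esub> \<in> carrier (quot_space V U)"
      using U0 by (auto simp: quot_space_def car intro!: bexI[of _ "\<zero>\<^bsub>V\<^esub>"])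
  next
    fix x assume "x \<in> carrier (quot_space V U)"
    then obtain a where a: "a \<in> carrier V" "x = U +>\<^bsub>V\<^esub> a" by (auto simp: quot_space_def car)
    show "\<zero>\<^bsub>quot_space V U\<^esub> \<oplus>\<^bsub>quot_space V U\<^esub> x = x"
      using add[of "\<zero>\<^bsub>V\<^esub>" a] a U0 by (simp add: quot_space_def)
    show "\<exists>y\<in>carrier (quot_space V U). y \<oplus>\<^bsub>quot_space V U\<^esub> x = \<zero>\<^bsub>quot_space V U\<^esub>"
      using add[of "\<ominus>\<^bsub>V\<^esub> a" a] a U0
      by (intro bexI[of _ "U +>\<^bsub>V\<^esub> (\<ominus>\<^bsub>V\<^esub> a)"]) (auto simp: quot_space_def car V.M.l_neg)
  qed (auto simp: quot_space_def car add V.M.a_ac)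
  have smq: "c \<odot>\<^bsub>quot_space V U\<^esub> (U +>\<^bsub>V\<^esub> x) = U +>\<^bsub>V\<^esub> (c \<odot>\<^bsub>V\<^esub> x)"
    if "x \<in> carrier V" "c \<in> carrier K" for c x
    using sm[OF that] by (simp add: quot_space_def)
  have addq: "(U +>\<^bsub>V\<^esub> x) \<oplus>\<^bsub>quot_space V U\<^esub> (U +>\<^bsub>V\<^esub> y) = U +>\<^bsub>V\<^esub> (x \<oplus>\<^bsub>V\<^esub> y)"
    if "x \<in> carrier V" "y \<in> carrier V" for x y
    using add[OF that] by (simp add: quot_space_def)
  have carq: "X \<in> carrier (quot_space V U) \<longleftrightarrow> (\<exists>x\<in>carrier V. X = U +>\<^bsub>V\<^esub> x)" for X
    by (simp add: quot_space_def car)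
  have "module_axioms K (quot_space V U)"
    by (rule module_axioms.intro)
       (auto simp: carq smq addq V.smult_l_distr V.smult_r_distr V.smult_assoc1)
  then show ?thesis
    unfolding vectorspace_def module_def using ab V.R.is_cring V.field_axioms by blast
qed

text \<open>\<open>vectorspace.dim\<close> is only meaningful together with \<open>vectorspace.fin_dim\<close>.\<close>

definition has_codim ::
  "('k, 'r) ring_scheme \<Rightarrow> ('k, 'a) module \<Rightarrow> 'a set \<Rightarrow> nat \<Rightarrow> bool" where
  "has_codim K V U n \<longleftrightarrow>
     vectorspace.fin_dim K (quot_space V U) \<and> vectorspace.dim K (quot_space V U) = n"


section \<open>Extensions\<close>

type_synonym ('k, 'w, 'a, 'q) ext = "('k, 'a) module \<times> ('w \<Rightarrow> 'a) \<times> ('a \<Rightarrow> 'q)"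

definition is_extension ::
  "('k, 'r) ring_scheme \<Rightarrow> ('k, 'q) module \<Rightarrow> ('k, 'w) module \<Rightarrow> ('k, 'w, 'a, 'q) ext \<Rightarrow> bool" where
  "is_extension K Q W = (\<lambda>(A, i, \<pi>).
     assoc_algebra K Q \<and> assoc_algebra K W \<and> assoc_algebra K A \<and>
     i \<in> alg_hom K W A \<and> \<pi> \<in> alg_hom K A Q \<and>
     inj_on i (carrier W) \<and>
     i ` carrier W = a_kernel A Q \<pi> \<and>
     \<pi> ` carrier A = carrier Q)"

text \<open>The two extensions may live in different types.\<close>

definition ext_equiv ::
  "('k, 'r) ring_scheme \<Rightarrow> ('k, 'q) module \<Rightarrow> ('k, 'w) module
    \<Rightarrow> ('k, 'w, 'a, 'q) ext \<Rightarrow> ('k, 'w, 'b, 'q) ext \<Rightarrow> bool" where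
  "ext_equiv K Q W = (\<lambda>(A, i, \<pi>) (B, j, \<rho>).
     \<exists>\<phi> \<in> alg_hom K A B.
       (\<forall>w \<in> carrier W. \<phi> (i w) = j w) \<and> (\<forall>a \<in> carrier A. \<rho> (\<phi> a) = \<pi> a))"

text \<open>
  \<open>Ext K Q W\<close> at type \<open>'a\<close> consists of the classes of extensions whose middle term has its carrier
  in \<open>'a\<close>.  The middle term of an extension is in bijection with \<open>carrier Q \<times> carrier W\<close>, so all
  extensions are represented as soon as this set injects into \<open>'a\<close>.  \<open>ext_class K Q W E\<close> at
  type \<open>'a\<close> is the class of an extension \<open>E\<close>, which itself may live in another type.
\<close>

definition Ext ::
  "('k, 'r) ring_scheme \<Rightarrow> ('k, 'q) module \<Rightarrow> ('k, 'w) module \<Rightarrow> ('k, 'w, 'a, 'q) ext set set" where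
  "Ext K Q W = {E. is_extension K Q W E} //
     {(E, F). is_extension K Q W E \<and> is_extension K Q W F \<and> ext_equiv K Q W E F}"

definition ext_class ::
  "('k, 'r) ring_scheme \<Rightarrow> ('k, 'q) module \<Rightarrow> ('k, 'w) module
    \<Rightarrow> ('k, 'w, 'b, 'q) ext \<Rightarrow> ('k, 'w, 'a, 'q) ext set" where
  "ext_class K Q W E = {F. is_extension K Q W F \<and> ext_equiv K Q W E F}"

text \<open>
  The kernel term and the quotient term are taken with carriers in \<open>'a\<close> and \<open>'a set\<close>; by
  \<open>metabelianI\<close> below this is no restriction.
\<close>

definition metabelian :: "('k, 'r) ring_scheme \<Rightarrow> ('k, 'a) module \<Rightarrow> bool" where
  "metabelian K A \<longleftrightarrow>
     (\<exists>(Q :: ('k, 'a set) module) (W :: ('k, 'a) module) i \<pi>.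
        is_extension K Q W (A, i, \<pi>) \<and> abelian_alg Q \<and> abelian_alg W)"

lemma alg_hom_D:
  assumes "f \<in> alg_hom K A B"
  shows "x \<in> carrier A \<Longrightarrow> f x \<in> carrier B"
    "x \<in> carrier A \<Longrightarrow> y \<in> carrier A \<Longrightarrow> f (x \<oplus>\<^bsub>A\<^esub> y) = f x \<oplus>\<^bsub>B\<^esub> f y"
    "c \<in> carrier K \<Longrightarrow> x \<in> carrier A \<Longrightarrow> f (c \<odot>\<^bsub>A\<^esub> x) = c \<odot>\<^bsub>B\<^esub> f x"
    "x \<in> carrier A \<Longrightarrow> y \<in> carrier A \<Longrightarrow> f (x \<otimes>\<^bsub>A\<^esub> y) = f x \<otimes>\<^bsub>B\<^esub> f y"
  using assms by (auto simp: alg_hom_def module_hom_def)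

lemma assoc_algebra_alt:
  "assoc_algebra K A \<longleftrightarrow> vectorspace K A \<and> (
    (\<forall>x\<in>carrier A. \<forall>y\<in>carrier A. x \<otimes>\<^bsub>A\<^esub> y \<in> carrier A) \<and>
    (\<forall>x\<in>carrier A. \<forall>y\<in>carrier A. \<forall>z\<in>carrier A.
      (x \<oplus>\<^bsub>A\<^esub> y) \<otimes>\<^bsub>A\<^esub> z = x \<otimes>\<^bsub>A\<^esub> z \<oplus>\<^bsub>A\<^esub> y \<otimes>\<^bsub>A\<^esub> z \<and>
      z \<otimes>\<^bsub>A\<^esub> (x \<oplus>\<^bsub>A\<^esub> y) = z \<otimes>\<^bsub>A\<^esub> x \<oplus>\<^bsub>A\<^esub> z \<otimes>\<^bsub>A\<^esub> y \<and>
      (x \<otimes>\<^bsub>A\<^esub> y) \<otimes>\<^bsub>A\<^esub> z = x \<otimes>\<^bsub>A\<^esub> (y \<otimes>\<^bsub>A\<^esub> z)) \<and>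
    (\<forall>c\<in>carrier K. \<forall>x\<in>carrier A. \<forall>y\<in>carrier A.
      (c \<odot>\<^bsub>A\<^esub> x) \<otimes>\<^bsub>A\<^esub> y = c \<odot>\<^bsub>A\<^esub> (x \<otimes>\<^bsub>A\<^esub> y) \<and>
      x \<otimes>\<^bsub>A\<^esub> (c \<odot>\<^bsub>A\<^esub> y) = c \<odot>\<^bsub>A\<^esub> (x \<otimes>\<^bsub>A\<^esub> y)))"
  (is "_ \<longleftrightarrow> ?V \<and> ?R")
proof
  assume A: "assoc_algebra K A"
  then interpret A: assoc_algebra K A .
  show "?V \<and> ?R"
    using A.vectorspace_axioms A.mult_bilinear A.mult_assoc
    by (simp add: bilinear_map_def module_hom_def Pi_def)
next
  assume "?V \<and> ?R"
  then show "assoc_algebra K A"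
    by (simp add: assoc_algebra_def assoc_algebra_axioms_def bilinear_map_def module_hom_def Pi_def)
qed

text \<open>Transport of structure along an injection \<open>g\<close> with left inverse \<open>h\<close>.\<close>

definition transport :: "('q \<Rightarrow> 's) \<Rightarrow> ('s \<Rightarrow> 'q) \<Rightarrow> ('k,'q) module \<Rightarrow> ('k,'s) module" where
  "transport g h Q = \<lparr>carrier = g ` carrier Q, mult = (\<lambda>X Y. g (h X \<otimes>\<^bsub>Q\<^esub> h Y)),
    one = g \<one>\<^bsub>Q\<^esub>, zero = g \<zero>\<^bsub>Q\<^esub>, add = (\<lambda>X Y. g (h X \<oplus>\<^bsub>Q\<^esub> h Y)),
    smult = (\<lambda>c X. g (c \<odot>\<^bsub>Q\<^esub> h X))\<rparr>"

lemma transport_algebra: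
  assumes Q: "assoc_algebra K Q" and h: "\<And>q. q \<in> carrier Q \<Longrightarrow> h (g q) = q"
  shows "assoc_algebra K (transport g h Q)"
proof -
  interpret Q: assoc_algebra K Q by fact
  note A = Q[unfolded assoc_algebra_alt]
  have "abelian_group (transport g h Q)"
  proof (rule abelian_groupI)
    fix x assume "x \<in> carrier (transport g h Q)"
    then obtain q where q: "q \<in> carrier Q" "x = g q" by (auto simp: transport_def)
    show "\<exists>y\<in>carrier (transport g h Q). y \<oplus>\<^bsub>transport g h Q\<^esub> x = \<zero>\<^bsub>transport g h Q\<^esub>"
      using q h by (auto simp: transport_def Q.M.l_neg intro!: bexI[of _ "\<ominus>\<^bsub>Q\<^esub> q"])
  qed (auto simp: transport_def h Q.M.a_assoc intro!: arg_cong[where f=g] Q.M.a_comm)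
  moreover have "module_axioms K (transport g h Q)"
    by (rule module_axioms.intro)
       (auto simp: transport_def h Q.smult_l_distr Q.smult_r_distr Q.smult_assoc1)
  ultimately have "vectorspace K (transport g h Q)"
    unfolding vectorspace_def module_def using Q.R.is_cring Q.field_axioms by blast
  then show ?thesis unfolding assoc_algebra_alt
    using A by (auto simp: transport_def h)
qed

lemma metabelianI:
  fixes Q :: "('k, 'q) module" and W :: "('k, 'w) module" and A :: "('k, 'a) module"
  assumes E: "is_extension K Q W (A, i, \<pi>)" and ab: "abelian_alg Q" "abelian_alg W"
  shows "metabelian K A"
proof -
  from E have QA: "assoc_algebra K Q" and WA: "assoc_algebra K W" and AA: "assoc_algebra K A"
    and i: "i \<in> alg_hom K W A" and p: "\<pi> \<in> alg_hom K A Q"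
    and ker: "i ` carrier W = a_kernel A Q \<pi>" and sur: "\<pi> ` carrier A = carrier Q"
    by (auto simp: is_extension_def)
  interpret Q: assoc_algebra K Q by fact
  interpret W: assoc_algebra K W by fact
  interpret A: assoc_algebra K A by fact
  note iD = alg_hom_D[OF i] and pD = alg_hom_D[OF p]
  note AE = AA[unfolded assoc_algebra_alt] and WE = WA[unfolded assoc_algebra_alt]
    and QE = QA[unfolded assoc_algebra_alt]
  define W' where "W' = A\<lparr>carrier := i ` carrier W\<rparr>"
  interpret I: mod_hom K W A i
    using i by unfold_locales (auto simp: alg_hom_def)
  have "submodule K I.im A" by (rule I.im_is_submodule)
  then have sub: "subspace K (i ` carrier W) A"
    using A.vectorspace_axioms by (simp add: subspace_def I.im_def)
  have vW': "vectorspace K W'" unfolding W'_def by (rule A.subspace_is_vs[OF sub])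
  have aW': "assoc_algebra K W'"
    unfolding assoc_algebra_alt using vW' AE WE iD by (auto simp: W'_def iD(4)[symmetric])
  have abW': "abelian_alg W'"
    using ab(2) by (auto simp: abelian_alg_def W'_def iD(4)[symmetric])
  define g where "g = (\<lambda>q. {a \<in> carrier A. \<pi> a = q})"
  define h where "h = (\<lambda>X. the_elem (\<pi> ` X))"
  have hg: "h (g q) = q" if "q \<in> carrier Q" for q
  proof -
    have "q \<in> \<pi> ` carrier A" using that sur by simp
    then obtain a where "a \<in> carrier A" "\<pi> a = q" by (elim imageE) simp
    then have "\<pi> ` g q = {q}" by (auto simp: g_def)
    then show ?thesis by (simp add: h_def)
  qed
  define Q' where "Q' = transport g h Q"
  have aQ': "assoc_algebra K Q'" unfolding Q'_def using QA hg by (rule transport_algebra)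
  have abQ': "abelian_alg Q'"
    using ab(1) hg by (auto simp: abelian_alg_def Q'_def transport_def)
  have inj: "inj_on g (carrier Q)" using hg by (rule inj_on_inverseI)
  have "is_extension K Q' W' (A, (\<lambda>x. x), g \<circ> \<pi>)"
    unfolding is_extension_def prod.case
  proof (intro conjI aQ' aW' AA)
    show "(\<lambda>x. x) \<in> alg_hom K W' A"
      by (auto simp: alg_hom_def module_hom_def W'_def iD)
    show "g \<circ> \<pi> \<in> alg_hom K A Q'"
      using AE by (auto simp: alg_hom_def module_hom_def Q'_def transport_def pD hg)
    show "(\<lambda>x. x) ` carrier W' = a_kernel A Q' (g \<circ> \<pi>)"
      using ker inj pD
      by (auto simp: W'_def a_kernel_def' Q'_def transport_def inj_on_eq_iff)
    show "(g \<circ> \<pi>) ` carrier A = carrier Q'"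
      by (simp only: image_comp[symmetric] sur) (simp add: Q'_def transport_def)
  qed auto
  then show ?thesis using abQ' abW' unfolding metabelian_def by (intro exI conjI)
qed


section \<open>Metabelian data and metabelian products\<close>

text \<open>
  The bilinear maps of a datum are uncurried, in the order of their arguments in
  \<open>x \<triangleleft> p\<close>, \<open>p \<triangleright> x\<close>, \<open>\<theta>(p, q)\<close>.  They are extensional, as are the endomorphisms below,
  so that they are determined by their values on the carriers.
\<close>

type_synonym ('p, 'v) met_datum = "('v \<times> 'p \<Rightarrow> 'v) \<times> ('p \<times> 'v \<Rightarrow> 'v) \<times> ('p \<times> 'p \<Rightarrow> 'v)"

definition Met ::
  "('k, 'r) ring_scheme \<Rightarrow> ('k, 'p) module \<Rightarrow> ('k, 'v) module \<Rightarrow> ('p, 'v) met_datum set" where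
  "Met K P V = {(tl, tr, \<theta>).
     tl \<in> extensional (carrier V \<times> carrier P) \<and> bilinear_map K V P V tl \<and>
     tr \<in> extensional (carrier P \<times> carrier V) \<and> bilinear_map K P V V tr \<and>
     \<theta> \<in> extensional (carrier P \<times> carrier P) \<and> bilinear_map K P P V \<theta> \<and>
     (\<forall>p \<in> carrier P. \<forall>q \<in> carrier P. \<forall>r \<in> carrier P. \<forall>x \<in> carrier V.
        tl (tl (x, p), q) = \<zero>\<^bsub>V\<^esub> \<and>
        tr (p, tr (q, x)) = \<zero>\<^bsub>V\<^esub> \<and>
        tr (p, tl (x, q)) = tl (tr (p, x), q) \<and>
        tr (p, \<theta> (q, r)) = tl (\<theta> (p, q), r))}"

definition met_prod ::
  "('k, 'p) module \<Rightarrow> ('k, 'v) module \<Rightarrow> ('p, 'v) met_datum \<Rightarrow> ('k, 'p \<times> 'v) module" where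
  "met_prod P V = (\<lambda>(tl, tr, \<theta>). (direct_sum P V)\<lparr>mult := \<lambda>(p, x) (q, y).
     (\<zero>\<^bsub>P\<^esub>, \<theta> (p, q) \<oplus>\<^bsub>V\<^esub> tr (p, y) \<oplus>\<^bsub>V\<^esub> tl (x, q))\<rparr>)"


section \<open>The case of a one-dimensional quotient\<close>

definition End_space :: "('k, 'r) ring_scheme \<Rightarrow> ('k, 'v) module \<Rightarrow> ('v \<Rightarrow> 'v) set" where
  "End_space K V = module_hom K V V \<inter> extensional (carrier V)"

definition T_pairs ::
  "('k, 'r) ring_scheme \<Rightarrow> ('k, 'v) module \<Rightarrow> (('v \<Rightarrow> 'v) \<times> ('v \<Rightarrow> 'v)) set" where
  "T_pairs K V = {(l, L) \<in> End_space K V \<times> End_space K V.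
     \<forall>x \<in> carrier V. l (l x) = \<zero>\<^bsub>V\<^esub> \<and> L (L x) = \<zero>\<^bsub>V\<^esub> \<and> L (l x) = l (L x)}"

definition Ker_diff :: "('k, 'v) module \<Rightarrow> ('v \<Rightarrow> 'v) \<Rightarrow> ('v \<Rightarrow> 'v) \<Rightarrow> 'v set" where
  "Ker_diff V l L = a_kernel V V (\<lambda>x. L x \<ominus>\<^bsub>V\<^esub> l x)"

definition Im_sum :: "('k, 'v) module \<Rightarrow> ('v \<Rightarrow> 'v) \<Rightarrow> ('v \<Rightarrow> 'v) \<Rightarrow> 'v set" where
  "Im_sum V l L = (\<lambda>x. L x \<oplus>\<^bsub>V\<^esub> l x) ` carrier V"

lemma Im_sum_subspace_Ker_diff:
  assumes V: "vectorspace K V" and T: "(l, L) \<in> T_pairs K V"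
  shows "subspace K (Im_sum V l L) (V\<lparr>carrier := Ker_diff V l L\<rparr>)"
proof -
  interpret V: vectorspace K V by fact
  have l: "l \<in> module_hom K V V" and L: "L \<in> module_hom K V V"
    and r: "\<And>x. x \<in> carrier V \<Longrightarrow> l (l x) = \<zero>\<^bsub>V\<^esub>" "\<And>x. x \<in> carrier V \<Longrightarrow> L (L x) = \<zero>\<^bsub>V\<^esub>"
     "\<And>x. x \<in> carrier V \<Longrightarrow> L (l x) = l (L x)"
    using T by (auto simp: T_pairs_def End_space_def)
  interpret l: mod_hom K V V l by unfold_locales fact
  interpret L: mod_hom K V V L by unfold_locales fact
  have lc: "l x \<in> carrier V" "L x \<in> carrier V" if "x \<in> carrier V" for x using that by (auto)
  have "(\<lambda>x. L x \<ominus>\<^bsub>V\<^esub> l x) \<in> module_hom K V V"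
    by (auto simp: module_hom_def lc V.M.minus_eq V.M.minus_add V.smult_r_distr V.smult_r_minus V.M.a_ac)
  then interpret D: mod_hom K V V "\<lambda>x. L x \<ominus>\<^bsub>V\<^esub> l x" by unfold_locales
  have "(\<lambda>x. L x \<oplus>\<^bsub>V\<^esub> l x) \<in> module_hom K V V"
    by (auto simp: module_hom_def lc V.smult_r_distr V.M.a_ac)
  then interpret S: mod_hom K V V "\<lambda>x. L x \<oplus>\<^bsub>V\<^esub> l x" by unfold_locales
  have K: "Ker_diff V l L = D.ker" by (auto simp: Ker_diff_def a_kernel_def' D.ker_def)
  have I: "Im_sum V l L = S.im" by (auto simp: Im_sum_def S.im_def)
  have sK: "submodule K D.ker V" by (rule D.ker_is_submodule)
  have sI: "submodule K S.im V" by (rule S.im_is_submodule)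
  have "S.im \<subseteq> D.ker"
    unfolding S.im_def D.ker_def by (auto simp: r lc V.M.minus_eq V.M.r_neg)
  then show ?thesis
    unfolding subspace_def K I
    using sI V.subspace_is_vs[of D.ker] sK V.vectorspace_axioms
      V.submodule_is_module[OF sK]
    by (auto simp: submodule_def subspace_def)
qed

definition scalar_datum ::
  "('k, 'r) ring_scheme \<Rightarrow> ('k, 'v) module \<Rightarrow> ('v \<Rightarrow> 'v) \<Rightarrow> ('v \<Rightarrow> 'v) \<Rightarrow> 'v \<Rightarrow> ('k, 'v) met_datum"
where
  "scalar_datum K V l L z =
     (restrict (\<lambda>(x, p). p \<odot>\<^bsub>V\<^esub> l x) (carrier V \<times> carrier K),
      restrict (\<lambda>(p, x). p \<odot>\<^bsub>V\<^esub> L x) (carrier K \<times> carrier V),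
      restrict (\<lambda>(p, q). (p \<otimes>\<^bsub>K\<^esub> q) \<odot>\<^bsub>V\<^esub> z) (carrier K \<times> carrier K))"

definition k_star ::
  "('k, 'r) ring_scheme \<Rightarrow> ('k, 'v) module \<Rightarrow> ('v \<Rightarrow> 'v) \<Rightarrow> ('v \<Rightarrow> 'v) \<Rightarrow> 'v \<Rightarrow> ('k, 'k \<times> 'v) module"
where
  "k_star K V l L z = met_prod (self_space K) V (scalar_datum K V l L z)"

end

theory Submission
  imports Defs
begin

text \<open>
  In an extension of \<open>k\<^sub>0\<close> by \<open>V\<^sub>0\<close> choose a preimage \<open>a\<close> of \<open>1\<close>.  Left and right multiplication by
  \<open>a\<close> preserve the kernel \<open>V\<close> and are \<open>\<Lambda>\<close> and \<open>\<lambda>\<close>, while \<open>\<zeta> = a\<^sup>2\<close>; associativity together with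
  \<open>V \<cdot> V = 0\<close> gives all the relations, and \<open>(p, x) \<mapsto> p a + x\<close> identifies the extension with the
  metabelian product.  Another choice \<open>a + v\<close> leaves \<open>\<lambda>\<close> and \<open>\<Lambda>\<close> unchanged and replaces \<open>\<zeta>\<close> by
  \<open>\<zeta> + \<Lambda> v + \<lambda> v\<close>, whence the quotient by the image of \<open>\<Lambda> + \<lambda>\<close>.  In a metabelian algebra the
  derived algebra lies in the abelian kernel, so its own multiplication is zero; if its codimension is one,
  it is the kernel of a functional, which makes the algebra an extension of \<open>k\<^sub>0\<close>.
\<close>

section \<open>Introduction rules, the line as a space over itself, and trivial
  multiplications\<close>

lemma module_homI:
  assumes "\<And>x. x \<in> carrier M \<Longrightarrow> f x \<in> carrier N"
    and "\<And>x y. x \<in> carrier M \<Longrightarrow> y \<in> carrier M \<Longrightarrow> f (x \<oplus>\<^bsub>M\<^esub> y) = f x \<oplus>\<^bsub>N\<^esub> f y"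
    and "\<And>c x. c \<in> carrier R \<Longrightarrow> x \<in> carrier M \<Longrightarrow> f (c \<odot>\<^bsub>M\<^esub> x) = c \<odot>\<^bsub>N\<^esub> f x"
  shows "f \<in> module_hom R M N"
  using assms by (auto simp: module_hom_def)

lemma alg_homI:
  assumes "f \<in> module_hom K A B"
    and "\<And>x y. x \<in> carrier A \<Longrightarrow> y \<in> carrier A \<Longrightarrow> f (x \<otimes>\<^bsub>A\<^esub> y) = f x \<otimes>\<^bsub>B\<^esub> f y"
  shows "f \<in> alg_hom K A B"
  using assms by (simp add: alg_hom_def)

lemma self_space_simps [simp]:
  "carrier (self_space K) = carrier K" "zero (self_space K) = \<zero>\<^bsub>K\<^esub>"
  "add (self_space K) = add K" "smult (self_space K) = mult K"
  by (simp_all add: self_space_def)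

lemma trivial_alg_simps [simp]:
  "carrier (trivial_alg V) = carrier V" "zero (trivial_alg V) = zero V"
  "add (trivial_alg V) = add V" "smult (trivial_alg V) = smult V"
  "x \<otimes>\<^bsub>trivial_alg V\<^esub> y = \<zero>\<^bsub>V\<^esub>"
  by (simp_all add: trivial_alg_def)

text \<open>The vector space axioms involve only these four fields of the module record. This
  carries them over to records in which the multiplication has been replaced, as in
  \<open>trivial_alg\<close> and \<open>met_prod\<close>.\<close>

lemma vectorspace_cong:
  assumes V: "vectorspace K V"
    and eq: "carrier W = carrier V" "zero W = zero V" "add W = add V" "smult W = smult V"
  shows "vectorspace K W"
proof -
  interpret V: vectorspace K V by fact
  have "abelian_group W"
  proof (rule abelian_groupI)
    show "\<exists>y\<in>carrier W. y \<oplus>\<^bsub>W\<^esub> x = \<zero>\<^bsub>W\<^esub>" if "x \<in> carrier W" for x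
      using that by (intro bexI[of _ "\<ominus>\<^bsub>V\<^esub> x"]) (simp_all add: eq V.M.l_neg)
  qed (simp_all add: eq V.M.a_ac)
  moreover have "module_axioms K W"
    by (rule module_axioms.intro)
       (auto simp: eq V.smult_l_distr V.smult_r_distr V.smult_assoc1)
  ultimately show ?thesis
    unfolding vectorspace_def module_def using V.R.is_cring V.field_axioms by blast
qed

lemma self_space_vectorspace:
  assumes "field K" shows "vectorspace K (self_space K)"
proof -
  interpret field K by fact
  have "abelian_group (self_space K)"
  proof (rule abelian_groupI)
    show "\<exists>y\<in>carrier (self_space K). y \<oplus>\<^bsub>self_space K\<^esub> x = \<zero>\<^bsub>self_space K\<^esub>"
      if "x \<in> carrier (self_space K)" for x
      using that by (intro bexI[of _ "\<ominus>\<^bsub>K\<^esub> x"]) (simp_all add: l_neg)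
  qed (simp_all add: a_ac)
  moreover have "module_axioms K (self_space K)"
    by (rule module_axioms.intro) (auto simp: l_distr r_distr m_assoc)
  ultimately show ?thesis
    unfolding vectorspace_def module_def using is_cring field_axioms by blast
qed

lemma trivial_alg_assoc_algebra:
  assumes "vectorspace K V" shows "assoc_algebra K (trivial_alg V)"
proof -
  interpret V: vectorspace K V by fact
  have "vectorspace K (trivial_alg V)" using assms by (rule vectorspace_cong) simp_all
  then show ?thesis by (auto simp: assoc_algebra_alt)
qed

section \<open>Equivalence of extensions\<close>

text \<open>Composition of the two morphisms. The middle terms may have three different types, so
  that extensions of one type can be compared through an extension of another.\<close>

lemma ext_equiv_trans:
  assumes "ext_equiv K Q W E F" "ext_equiv K Q W F G" shows "ext_equiv K Q W E G"
proof -
  obtain A i p where E: "E = (A, i, p)" by (cases E)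
  obtain B j q where F: "F = (B, j, q)" by (cases F)
  obtain C k r where G: "G = (C, k, r)" by (cases G)
  obtain f where f: "f \<in> alg_hom K A B" "\<forall>w\<in>carrier W. f (i w) = j w" "\<forall>a\<in>carrier A. q (f a) = p a"
    using assms(1) by (auto simp: ext_equiv_def E F)
  obtain g where g: "g \<in> alg_hom K B C" "\<forall>w\<in>carrier W. g (j w) = k w" "\<forall>a\<in>carrier B. r (g a) = q a"
    using assms(2) by (auto simp: ext_equiv_def F G)
  have "g \<circ> f \<in> alg_hom K A C"
    by (intro alg_homI module_homI) (simp_all add: alg_hom_D[OF f(1)] alg_hom_D[OF g(1)])
  then show ?thesis unfolding ext_equiv_def E G prod.case
    by (rule bexI[rotated]) (use f g in \<open>auto simp: alg_hom_D[OF f(1)]\<close>)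
qed

text \<open>The short five lemma for a morphism that is the identity on both ends. It makes every
  equivalence of extensions an isomorphism of the middle terms.\<close>

lemma ext_morphism_bij:
  assumes E: "is_extension K Q W (A, i, \<pi>)" and F: "is_extension K Q W (B, j, \<rho>)"
    and f: "f \<in> alg_hom K A B" "\<And>w. w \<in> carrier W \<Longrightarrow> f (i w) = j w"
      "\<And>a. a \<in> carrier A \<Longrightarrow> \<rho> (f a) = \<pi> a"
  shows "bij_betw f (carrier A) (carrier B)"
proof -
  interpret Q: assoc_algebra K Q using E by (simp add: is_extension_def)
  interpret W: assoc_algebra K W using E by (simp add: is_extension_def)
  interpret A: assoc_algebra K A using E by (simp add: is_extension_def)
  interpret B: assoc_algebra K B using F by (simp add: is_extension_def)
  have h: "i \<in> alg_hom K W A" "\<pi> \<in> alg_hom K A Q" "j \<in> alg_hom K W B" "\<rho> \<in> alg_hom K B Q"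
    and ji: "inj_on j (carrier W)"
    and keri: "i ` carrier W = a_kernel A Q \<pi>" and kerj: "j ` carrier W = a_kernel B Q \<rho>"
    and sur: "\<pi> ` carrier A = carrier Q"
    using E F by (auto simp: is_extension_def)
  interpret f: mod_hom K A B f using f(1) by unfold_locales (simp add: alg_hom_def)
  interpret i: mod_hom K W A i using h(1) by unfold_locales (simp add: alg_hom_def)
  interpret j: mod_hom K W B j using h(3) by unfold_locales (simp add: alg_hom_def)
  interpret p: mod_hom K A Q \<pi> using h(2) by unfold_locales (simp add: alg_hom_def)
  interpret r: mod_hom K B Q \<rho> using h(4) by unfold_locales (simp add: alg_hom_def)
  \<comment> \<open>If \<open>f\<close> kills \<open>a\<close>, then so does \<open>\<pi>\<close>,
    hence \<open>a = i w\<close> by exactness; now \<open>j w = f (i w) = 0\<close> and injectivity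
    of \<open>j\<close> forces \<open>w = 0\<close>.\<close>
  have ker0: "a = \<zero>\<^bsub>A\<^esub>" if a: "a \<in> carrier A" "f a = \<zero>\<^bsub>B\<^esub>" for a
  proof -
    have "\<pi> a = \<zero>\<^bsub>Q\<^esub>" using f(3)[OF a(1)] a by simp
    then have "a \<in> i ` carrier W" using a keri by (simp add: a_kernel_def')
    then obtain w where w: "w \<in> carrier W" "a = i w" by auto
    then have "j w = j \<zero>\<^bsub>W\<^esub>" using f(2) a by simp
    then have "w = \<zero>\<^bsub>W\<^esub>" using ji w by (meson W.M.zero_closed inj_onD)
    then show ?thesis using w by simp
  qed
  have "inj_on f (carrier A)"
  proof (rule inj_onI)
    fix x y assume xy: "x \<in> carrier A" "y \<in> carrier A" "f x = f y"
    then have "f (x \<ominus>\<^bsub>A\<^esub> y) = \<zero>\<^bsub>B\<^esub>" by (simp add: B.M.minus_eq B.M.r_neg)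
    then have "x \<ominus>\<^bsub>A\<^esub> y = \<zero>\<^bsub>A\<^esub>" using xy ker0 by blast
    then show "x = y" using xy by simp
  qed
  \<comment> \<open>Choose \<open>a\<close> over \<open>\<rho> b\<close>. The difference of
    \<open>b\<close> and \<open>f a\<close> lies in the kernel of \<open>\<rho>\<close>, so it is
    some \<open>j w = f (i w)\<close>, and \<open>i w + a\<close> is a preimage of
    \<open>b\<close>.\<close>
  moreover have "b \<in> f ` carrier A" if b: "b \<in> carrier B" for b
  proof -
    have "\<rho> b \<in> \<pi> ` carrier A" using sur b by simp
    then obtain a where a: "a \<in> carrier A" "\<rho> b = \<pi> a" by auto
    then have "\<rho> (b \<ominus>\<^bsub>B\<^esub> f a) = \<zero>\<^bsub>Q\<^esub>" using b f(3) by (simp add: Q.M.minus_eq Q.M.r_neg)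
    then have "b \<ominus>\<^bsub>B\<^esub> f a \<in> j ` carrier W" using a b kerj by (simp add: a_kernel_def')
    then obtain w where w: "w \<in> carrier W" "b \<ominus>\<^bsub>B\<^esub> f a = f (i w)" using f(2) by auto
    then have "f (i w \<oplus>\<^bsub>A\<^esub> a) = (b \<ominus>\<^bsub>B\<^esub> f a) \<oplus>\<^bsub>B\<^esub> f a" using a by simp
    also have "\<dots> = b" using a b by (simp add: B.M.minus_eq B.M.a_assoc B.M.l_neg)
    finally show ?thesis using w(1) a(1)
      by (intro image_eqI[of _ _ "i w \<oplus>\<^bsub>A\<^esub> a"]) simp_all
  qed
  ultimately show ?thesis by (auto simp: bij_betw_def)
qed

text \<open>By the short five lemma the given morphism is bijective; its inverse is again a morphism
  and respects both ends.\<close>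

lemma ext_equiv_sym:
  assumes E: "is_extension K Q W E" and F: "is_extension K Q W F" and EF: "ext_equiv K Q W E F"
  shows "ext_equiv K Q W F E"
proof -
  obtain A i p where E': "E = (A, i, p)" by (cases E)
  obtain B j q where F': "F = (B, j, q)" by (cases F)
  interpret A: assoc_algebra K A using E by (simp add: is_extension_def E')
  interpret B: assoc_algebra K B using F by (simp add: is_extension_def F')
  obtain f where f: "f \<in> alg_hom K A B" "\<And>w. w\<in>carrier W \<Longrightarrow> f (i w) = j w" "\<And>a. a\<in>carrier A \<Longrightarrow> q (f a) = p a"
    using EF by (auto simp: ext_equiv_def E' F')
  have bij: "bij_betw f (carrier A) (carrier B)"
    using E F f by (intro ext_morphism_bij[where i = i and j = j and \<pi> = p and \<rho> = q]) (simp_all add: E' F')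
  define g where "g = inv_into (carrier A) f"
  have fg: "f (g b) = b" "g b \<in> carrier A" if "b \<in> carrier B" for b
    using bij that unfolding g_def by (auto simp: bij_betw_def f_inv_into_f inv_into_into)
  have gf: "g (f a) = a" if "a \<in> carrier A" for a
    using bij that unfolding g_def by (simp add: bij_betw_def)
  note fD = alg_hom_D[OF f(1)]
  have AE: "x \<otimes>\<^bsub>A\<^esub> y \<in> carrier A" if "x \<in> carrier A" "y \<in> carrier A" for x y
    using A.assoc_algebra_axioms that unfolding assoc_algebra_alt by blast
  have "g \<in> alg_hom K B A"
  proof (intro alg_homI module_homI)
    fix x y assume "x \<in> carrier B" "y \<in> carrier B"
    \<comment> \<open>Apply \<open>g\<close> to \<open>f (g x + g y) = x + y\<close>, and likewise
      for products.\<close>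
    then show "g (x \<oplus>\<^bsub>B\<^esub> y) = g x \<oplus>\<^bsub>A\<^esub> g y" "g (x \<otimes>\<^bsub>B\<^esub> y) = g x \<otimes>\<^bsub>A\<^esub> g y"
      using gf[of "g x \<oplus>\<^bsub>A\<^esub> g y"] gf[of "g x \<otimes>\<^bsub>A\<^esub> g y"] by (simp_all add: fg fD AE)
  next
    fix c x assume "c \<in> carrier K" "x \<in> carrier B"
    then show "g (c \<odot>\<^bsub>B\<^esub> x) = c \<odot>\<^bsub>A\<^esub> g x"
      using gf[of "c \<odot>\<^bsub>A\<^esub> g x"] by (simp add: fg fD)
  qed (rule fg)
  moreover have "i w \<in> carrier A" if "w \<in> carrier W" for w
    using E that alg_hom_D(1)[of i K W A] by (simp add: is_extension_def E')
  ultimately show ?thesis unfolding ext_equiv_def E' F' prod.case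
    by (intro bexI[of _ g] conjI ballI) (simp_all add: f(2)[symmetric] gf f(3)[symmetric] fg)
qed

text \<open>The classes are formed at a type that may differ from those of \<open>E\<close> and
  \<open>F\<close>, so both could be empty and therefore equal. The representative \<open>G\<close>
  rules this out: it lies in the class of \<open>E\<close>, and equality of the classes then links
  \<open>E\<close> to \<open>F\<close> through \<open>G\<close>.\<close>

lemma ext_class_eq_iff:
  assumes E: "is_extension K Q W E" and F: "is_extension K Q W F"
    and G: "is_extension K Q W (G :: ('k, 'w, 'e, 'q) ext)" "ext_equiv K Q W E G"
  shows "(ext_class K Q W E :: ('k, 'w, 'e, 'q) ext set) = ext_class K Q W F \<longleftrightarrow> ext_equiv K Q W E F"
proof
  assume "(ext_class K Q W E :: ('k, 'w, 'e, 'q) ext set) = ext_class K Q W F"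
  moreover have "G \<in> ext_class K Q W E" using G by (simp add: ext_class_def)
  ultimately have "ext_equiv K Q W F G" by (simp add: ext_class_def)
  then have "ext_equiv K Q W G F" by (rule ext_equiv_sym[OF F G(1)])
  with G(2) show "ext_equiv K Q W E F" by (rule ext_equiv_trans)
next
  assume EF: "ext_equiv K Q W E F"
  then have FE: "ext_equiv K Q W F E" by (rule ext_equiv_sym[OF E F])
  have "ext_equiv K Q W E H \<longleftrightarrow> ext_equiv K Q W F H" for H :: "('k, 'w, 'e, 'q) ext"
    using ext_equiv_trans[OF EF, of H] ext_equiv_trans[OF FE, of H] by blast
  then show "ext_class K Q W E = (ext_class K Q W F :: ('k, 'w, 'e, 'q) ext set)"
    by (simp add: ext_class_def)
qed

text \<open>Replaces the quotient by the equivalence relation with the classes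
  \<open>ext_class\<close>, which can also be formed for extensions living in another type.\<close>

lemma Ext_eq_image:
  "(Ext K Q W :: ('k, 'w, 'a, 'q) ext set set) = ext_class K Q W ` {E :: ('k, 'w, 'a, 'q) ext. is_extension K Q W E}"
  unfolding Ext_def quotient_def UNION_singleton_eq_range
proof (rule image_cong[OF refl])
  fix E :: "('k, 'w, 'a, 'q) ext" assume "E \<in> {E. is_extension K Q W E}"
  then have E: "is_extension K Q W E" by (rule CollectD)
  show "{(E, F). is_extension K Q W E \<and> is_extension K Q W F \<and> ext_equiv K Q W E F} `` {E}
      = (ext_class K Q W E :: ('k, 'w, 'a, 'q) ext set)"
    using E by (simp add: ext_class_def Image_singleton)
qed

text \<open>Copies an extension into another type along an injection of its middle term. The
  injection itself is the morphism showing that the copy is equivalent to the original.\<close>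

lemma is_extension_transport:
  assumes E: "is_extension K Q W (A, i, \<pi>)" and j: "\<And>a. a \<in> carrier A \<Longrightarrow> h (j a) = a"
  shows "is_extension K Q W (transport j h A, j \<circ> i, \<pi> \<circ> h)" (is "is_extension K Q W ?F")
    and "ext_equiv K Q W (A, i, \<pi>) (transport j h A, j \<circ> i, \<pi> \<circ> h)"
proof -
  have a: "assoc_algebra K A" and i: "i \<in> alg_hom K W A" and p: "\<pi> \<in> alg_hom K A Q"
    and ker: "i ` carrier W = a_kernel A Q \<pi>" and sur: "\<pi> ` carrier A = carrier Q"
    and "assoc_algebra K Q" "assoc_algebra K W" "inj_on i (carrier W)"
    using E by (auto simp: is_extension_def)
  note AE = a[unfolded assoc_algebra_alt]
  interpret A: assoc_algebra K A by fact
  show "is_extension K Q W ?F"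
    unfolding is_extension_def prod.case
  proof (intro conjI transport_algebra)
    show "j \<circ> i \<in> alg_hom K W (transport j h A)"
      by (intro alg_homI module_homI) (auto simp: transport_def j alg_hom_D[OF i])
    show "\<pi> \<circ> h \<in> alg_hom K (transport j h A) Q"
      by (intro alg_homI module_homI) (use AE in \<open>auto simp: transport_def j alg_hom_D[OF p]\<close>)
    show "inj_on (j \<circ> i) (carrier W)"
      using \<open>inj_on i (carrier W)\<close> by (auto simp: inj_on_def) (metis alg_hom_D(1)[OF i] j)
    have "(j \<circ> i) ` carrier W = j ` a_kernel A Q \<pi>" by (simp only: ker[symmetric] image_comp)
    also have "\<dots> = a_kernel (transport j h A) Q (\<pi> \<circ> h)"
      by (auto simp: a_kernel_def' transport_def j)
    finally show "(j \<circ> i) ` carrier W = a_kernel (transport j h A) Q (\<pi> \<circ> h)" .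
    show "(\<pi> \<circ> h) ` carrier (transport j h A) = carrier Q"
      unfolding sur[symmetric] by (auto simp: transport_def image_image j)
  qed (simp_all add: j \<open>assoc_algebra K Q\<close> \<open>assoc_algebra K W\<close> \<open>assoc_algebra K A\<close>)
  have "j \<in> alg_hom K A (transport j h A)"
    by (intro alg_homI module_homI) (auto simp: transport_def j)
  then show "ext_equiv K Q W (A, i, \<pi>) ?F"
    unfolding ext_equiv_def prod.case by (intro bexI[of _ j]) (auto simp: j)
qed

section \<open>Metabelian products\<close>

lemma bilinear_map_D:
  assumes "bilinear_map K X Y Z f" "x \<in> carrier X" "y \<in> carrier Y"
  shows "f (x, y) \<in> carrier Z"
    "x' \<in> carrier X \<Longrightarrow> f (x \<oplus>\<^bsub>X\<^esub> x', y) = f (x, y) \<oplus>\<^bsub>Z\<^esub> f (x', y)"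
    "y' \<in> carrier Y \<Longrightarrow> f (x, y \<oplus>\<^bsub>Y\<^esub> y') = f (x, y) \<oplus>\<^bsub>Z\<^esub> f (x, y')"
    "c \<in> carrier K \<Longrightarrow> f (c \<odot>\<^bsub>X\<^esub> x, y) = c \<odot>\<^bsub>Z\<^esub> f (x, y)"
    "c \<in> carrier K \<Longrightarrow> f (x, c \<odot>\<^bsub>Y\<^esub> y) = c \<odot>\<^bsub>Z\<^esub> f (x, y)"
  using assms by (auto simp: bilinear_map_def module_hom_def)

lemma met_prod_simps [simp]:
  "carrier (met_prod P V D) = carrier P \<times> carrier V"
  "zero (met_prod P V D) = (\<zero>\<^bsub>P\<^esub>, \<zero>\<^bsub>V\<^esub>)"
  "(p, x) \<oplus>\<^bsub>met_prod P V D\<^esub> (q, y) = (p \<oplus>\<^bsub>P\<^esub> q, x \<oplus>\<^bsub>V\<^esub> y)"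
  "c \<odot>\<^bsub>met_prod P V D\<^esub> (p, x) = (c \<odot>\<^bsub>P\<^esub> p, c \<odot>\<^bsub>V\<^esub> x)"
  "(p, x) \<otimes>\<^bsub>met_prod P V (lt, rt, t)\<^esub> (q, y) = (\<zero>\<^bsub>P\<^esub>, t (p, q) \<oplus>\<^bsub>V\<^esub> rt (p, y) \<oplus>\<^bsub>V\<^esub> lt (x, q))"
  by (auto simp: met_prod_def direct_sum_def split: prod.splits)

lemma module_hom_zero:
  assumes "vectorspace K V" "vectorspace K W" "f \<in> module_hom K V W"
  shows "f \<zero>\<^bsub>V\<^esub> = \<zero>\<^bsub>W\<^esub>"
proof -
  interpret V: vectorspace K V by fact
  interpret W: vectorspace K W by fact
  interpret f: mod_hom K V W f using assms(3) by unfold_locales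
  show ?thesis by simp
qed

text \<open>A product of three elements has second component
  \<open>lt (t (p, q) + rt (p, y) + lt (x, q), r)\<close> when bracketed to the left, and
  \<open>rt (p, t (q, r) + rt (q, w) + lt (y, r))\<close> when bracketed to the right. The axioms of
  a datum kill the double actions \<open>lt lt\<close> and \<open>rt rt\<close> and match the other
  two pairs of terms.\<close>

lemma met_prod_extension:
  assumes P: "vectorspace K P" and V: "vectorspace K V" and D: "D \<in> Met K P V"
  shows "is_extension K (trivial_alg P) (trivial_alg V) (met_prod P V D, (\<lambda>x. (\<zero>\<^bsub>P\<^esub>, x)), fst)"
proof -
  interpret P: vectorspace K P by fact
  interpret V: vectorspace K V by fact
  obtain lt rt t where D': "D = (lt, rt, t)" by (cases D)
  have b: "bilinear_map K V P V lt" "bilinear_map K P V V rt" "bilinear_map K P P V t"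
    and rel: "\<And>p q x. \<lbrakk>p \<in> carrier P; q \<in> carrier P; x \<in> carrier V\<rbrakk> \<Longrightarrow> lt (lt (x, p), q) = \<zero>\<^bsub>V\<^esub>"
      "\<And>p q x. \<lbrakk>p \<in> carrier P; q \<in> carrier P; x \<in> carrier V\<rbrakk> \<Longrightarrow> rt (p, rt (q, x)) = \<zero>\<^bsub>V\<^esub>"
      "\<And>p q x. \<lbrakk>p \<in> carrier P; q \<in> carrier P; x \<in> carrier V\<rbrakk> \<Longrightarrow> rt (p, lt (x, q)) = lt (rt (p, x), q)"
      "\<And>p q r. \<lbrakk>p \<in> carrier P; q \<in> carrier P; r \<in> carrier P\<rbrakk> \<Longrightarrow> rt (p, t (q, r)) = lt (t (p, q), r)"
    \<comment> \<open>In \<open>Met_def\<close> all relations share one block of quantifiers; zero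
      is the value of \<open>x\<close> for the last relation, where \<open>x\<close> does not
      occur.\<close>
    using D V.M.zero_closed unfolding D' Met_def by blast+
  note l = bilinear_map_D[OF b(1)] and r = bilinear_map_D[OF b(2)] and t = bilinear_map_D[OF b(3)]
  \<comment> \<open>Every product has first component zero, so these values at zero remove the
    remaining terms when products are multiplied again.\<close>
  have z: "lt (x, \<zero>\<^bsub>P\<^esub>) = \<zero>\<^bsub>V\<^esub>" "rt (\<zero>\<^bsub>P\<^esub>, x) = \<zero>\<^bsub>V\<^esub>" if "x \<in> carrier V" for x
    using b that module_hom_zero[OF P V, of "\<lambda>p. lt (x, p)"] module_hom_zero[OF P V, of "\<lambda>p. rt (p, x)"]
    by (auto simp: bilinear_map_def)
  have z': "lt (\<zero>\<^bsub>V\<^esub>, p) = \<zero>\<^bsub>V\<^esub>" "rt (p, \<zero>\<^bsub>V\<^esub>) = \<zero>\<^bsub>V\<^esub>" "t (p, \<zero>\<^bsub>P\<^esub>) = \<zero>\<^bsub>V\<^esub>" "t (\<zero>\<^bsub>P\<^esub>, p) = \<zero>\<^bsub>V\<^esub>" 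
    if "p \<in> carrier P" for p
    using b that module_hom_zero[OF V V, of "\<lambda>x. lt (x, p)"] module_hom_zero[OF V V, of "\<lambda>x. rt (p, x)"]
      module_hom_zero[OF P V, of "\<lambda>q. t (p, q)"] module_hom_zero[OF P V, of "\<lambda>q. t (q, p)"]
    by (auto simp: bilinear_map_def)
  have vs: "vectorspace K (met_prod P V D)"
    by (rule vectorspace_cong[OF direct_sum_is_vs[OF P V]])
       (auto simp: met_prod_def direct_sum_def split: prod.splits)
  have alg: "assoc_algebra K (met_prod P V D)"
    unfolding assoc_algebra_alt
  proof (intro conjI vs)
    show "\<forall>x\<in>carrier (met_prod P V D). \<forall>y\<in>carrier (met_prod P V D).
        x \<otimes>\<^bsub>met_prod P V D\<^esub> y \<in> carrier (met_prod P V D)"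
      by (auto simp: D' l r t)
  next
    show "\<forall>x\<in>carrier (met_prod P V D). \<forall>y\<in>carrier (met_prod P V D). \<forall>z\<in>carrier (met_prod P V D).
       (x \<oplus>\<^bsub>met_prod P V D\<^esub> y) \<otimes>\<^bsub>met_prod P V D\<^esub> z =
       x \<otimes>\<^bsub>met_prod P V D\<^esub> z \<oplus>\<^bsub>met_prod P V D\<^esub> y \<otimes>\<^bsub>met_prod P V D\<^esub> z \<and>
       z \<otimes>\<^bsub>met_prod P V D\<^esub> (x \<oplus>\<^bsub>met_prod P V D\<^esub> y) =
       z \<otimes>\<^bsub>met_prod P V D\<^esub> x \<oplus>\<^bsub>met_prod P V D\<^esub> z \<otimes>\<^bsub>met_prod P V D\<^esub> y \<and>
       x \<otimes>\<^bsub>met_prod P V D\<^esub> y \<otimes>\<^bsub>met_prod P V D\<^esub> z = x \<otimes>\<^bsub>met_prod P V D\<^esub> (y \<otimes>\<^bsub>met_prod P V D\<^esub> z)"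
      by (auto simp: D' l r t z z' rel V.M.a_ac)
  next
    show "\<forall>c\<in>carrier K. \<forall>x\<in>carrier (met_prod P V D). \<forall>y\<in>carrier (met_prod P V D).
       (c \<odot>\<^bsub>met_prod P V D\<^esub> x) \<otimes>\<^bsub>met_prod P V D\<^esub> y = c \<odot>\<^bsub>met_prod P V D\<^esub> (x \<otimes>\<^bsub>met_prod P V D\<^esub> y) \<and>
       x \<otimes>\<^bsub>met_prod P V D\<^esub> (c \<odot>\<^bsub>met_prod P V D\<^esub> y) = c \<odot>\<^bsub>met_prod P V D\<^esub> (x \<otimes>\<^bsub>met_prod P V D\<^esub> y)"
      by (auto simp: D' l r t V.smult_r_distr)
  qed
  show ?thesis
    unfolding is_extension_def prod.case
  proof (intro conjI alg trivial_alg_assoc_algebra P V)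
    show "(\<lambda>x. (\<zero>\<^bsub>P\<^esub>, x)) \<in> alg_hom K (trivial_alg V) (met_prod P V D)"
      by (intro alg_homI module_homI) (auto simp: D' z z')
    show "fst \<in> alg_hom K (met_prod P V D) (trivial_alg P)"
      by (intro alg_homI module_homI) (auto simp: D')
    show "inj_on (\<lambda>x. (\<zero>\<^bsub>P\<^esub>, x)) (carrier (trivial_alg V))" by (simp add: inj_on_def)
    show "(\<lambda>x. (\<zero>\<^bsub>P\<^esub>, x)) ` carrier (trivial_alg V) = a_kernel (met_prod P V D) (trivial_alg P) fst"
      by (auto simp: a_kernel_def')
    show "fst ` carrier (met_prod P V D) = carrier (trivial_alg P)"
      using V.M.zero_closed by (force simp: image_iff)
  qed
qed

section \<open>Metabelian data of the line correspond to triples (\<lambda>, \<Lambda>,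
  \<zeta>)\<close>

lemma T_pairs_D:
  assumes "(l, L) \<in> T_pairs K V"
  shows "l \<in> module_hom K V V" "L \<in> module_hom K V V"
    "l \<in> extensional (carrier V)" "L \<in> extensional (carrier V)"
    "x \<in> carrier V \<Longrightarrow> l (l x) = \<zero>\<^bsub>V\<^esub>" "x \<in> carrier V \<Longrightarrow> L (L x) = \<zero>\<^bsub>V\<^esub>"
    "x \<in> carrier V \<Longrightarrow> L (l x) = l (L x)"
  using assms by (auto simp: T_pairs_def End_space_def)

lemma mem_Ker_diff_iff:
  assumes "vectorspace K V" "(l, L) \<in> T_pairs K V"
  shows "z \<in> Ker_diff V l L \<longleftrightarrow> z \<in> carrier V \<and> L z = l z"
proof -
  interpret V: vectorspace K V by fact
  have "l z \<in> carrier V" "L z \<in> carrier V" if "z \<in> carrier V"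
    using that T_pairs_D(1,2)[OF assms(2)] by (auto simp: module_hom_def)
  then show ?thesis by (auto simp: Ker_diff_def a_kernel_def')
qed

text \<open>After the scalars are pulled out, the first three axioms of a datum are the relations
  defining \<open>T_pairs\<close>, and the last one compares \<open>pqr\<close> times
  \<open>L z\<close> with \<open>pqr\<close> times \<open>l z\<close>, which agree on
  \<open>Ker_diff\<close>.\<close>

lemma scalar_datum_Met:
  assumes K: "field K" and V: "vectorspace K V"
    and T: "(l, L) \<in> T_pairs K V" and z: "z \<in> Ker_diff V l L"
  shows "scalar_datum K V l L z \<in> Met K (self_space K) V"
proof -
  interpret K: field K by fact
  interpret V: vectorspace K V by fact
  note TD = T_pairs_D[OF T]
  have zV: "z \<in> carrier V" "L z = l z" using z mem_Ker_diff_iff[OF V T] by auto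
  have hl: "l x \<in> carrier V" "L x \<in> carrier V" if "x \<in> carrier V" for x
    using that TD(1,2) by (auto simp: module_hom_def)
  have ha: "l (x \<oplus>\<^bsub>V\<^esub> y) = l x \<oplus>\<^bsub>V\<^esub> l y" "L (x \<oplus>\<^bsub>V\<^esub> y) = L x \<oplus>\<^bsub>V\<^esub> L y" if "x \<in> carrier V" "y \<in> carrier V" for x y
    using that TD(1,2) by (auto simp: module_hom_def)
  have hs: "l (c \<odot>\<^bsub>V\<^esub> x) = c \<odot>\<^bsub>V\<^esub> l x" "L (c \<odot>\<^bsub>V\<^esub> x) = c \<odot>\<^bsub>V\<^esub> L x" if "x \<in> carrier V" "c \<in> carrier K" for x c
    using that TD(1,2) by (auto simp: module_hom_def)
  show ?thesis
    by (auto simp: scalar_datum_def Met_def bilinear_map_def zV hl ha hs TD V.smult_l_distr V.smult_r_distr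
         V.smult_assoc1[symmetric] K.m_ac K.l_distr K.r_distr intro!: module_homI)
qed

text \<open>The line is spanned by one, so each bilinear map of the datum is determined by its
  values at one. These values are \<open>l'\<close>, \<open>L'\<close> and \<open>z\<close>, and the
  axioms at \<open>p = q = r = 1\<close> are the conditions on them.\<close>

lemma Met_scalar_datum:
  assumes K: "field K" and V: "vectorspace K V" and D: "D \<in> Met K (self_space K) V"
  obtains l L z where "(l, L) \<in> T_pairs K V" "z \<in> Ker_diff V l L" "D = scalar_datum K V l L z"
proof -
  interpret K: field K by fact
  interpret V: vectorspace K V by fact
  obtain lt rt t where D': "D = (lt, rt, t)" by (cases D)
  have b: "bilinear_map K V (self_space K) V lt" "bilinear_map K (self_space K) V V rt"
      "bilinear_map K (self_space K) (self_space K) V t"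
    and ext: "lt \<in> extensional (carrier V \<times> carrier K)" "rt \<in> extensional (carrier K \<times> carrier V)"
      "t \<in> extensional (carrier K \<times> carrier K)"
    and rel: "\<And>p q x. \<lbrakk>p \<in> carrier K; q \<in> carrier K; x \<in> carrier V\<rbrakk> \<Longrightarrow> lt (lt (x, p), q) = \<zero>\<^bsub>V\<^esub>"
      "\<And>p q x. \<lbrakk>p \<in> carrier K; q \<in> carrier K; x \<in> carrier V\<rbrakk> \<Longrightarrow> rt (p, rt (q, x)) = \<zero>\<^bsub>V\<^esub>"
      "\<And>p q x. \<lbrakk>p \<in> carrier K; q \<in> carrier K; x \<in> carrier V\<rbrakk> \<Longrightarrow> rt (p, lt (x, q)) = lt (rt (p, x), q)"
      "\<And>p q r. \<lbrakk>p \<in> carrier K; q \<in> carrier K; r \<in> carrier K\<rbrakk> \<Longrightarrow> rt (p, t (q, r)) = lt (t (p, q), r)"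
    using D V.M.zero_closed unfolding D' Met_def self_space_simps by blast+
  note l = bilinear_map_D[OF b(1), simplified] and r = bilinear_map_D[OF b(2), simplified]
    and t = bilinear_map_D[OF b(3), simplified]
  define l' where "l' = restrict (\<lambda>x. lt (x, \<one>\<^bsub>K\<^esub>)) (carrier V)"
  define L' where "L' = restrict (\<lambda>x. rt (\<one>\<^bsub>K\<^esub>, x)) (carrier V)"
  define z where "z = t (\<one>\<^bsub>K\<^esub>, \<one>\<^bsub>K\<^esub>)"
  have T: "(l', L') \<in> T_pairs K V"
    by (auto simp: T_pairs_def End_space_def l'_def L'_def l r rel intro!: module_homI)
  have "z \<in> Ker_diff V l' L'"
    unfolding mem_Ker_diff_iff[OF V T] by (simp add: z_def l'_def L'_def t rel)
  moreover have "lt (x, p) = p \<odot>\<^bsub>V\<^esub> l' x" "rt (p, x) = p \<odot>\<^bsub>V\<^esub> L' x"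
    if "p \<in> carrier K" "x \<in> carrier V" for p x
    using that l(5)[of x "\<one>\<^bsub>K\<^esub>" p] r(4)[of "\<one>\<^bsub>K\<^esub>" x p] by (simp_all add: l'_def L'_def)
  moreover have "t (p, q) = (p \<otimes>\<^bsub>K\<^esub> q) \<odot>\<^bsub>V\<^esub> z" if "p \<in> carrier K" "q \<in> carrier K" for p q
    using that t(4)[of "\<one>\<^bsub>K\<^esub>" q p] t(5)[of "\<one>\<^bsub>K\<^esub>" "\<one>\<^bsub>K\<^esub>" q]
    by (simp add: z_def V.smult_assoc1 t)
  \<comment> \<open>The computed values give equality on the carriers; off the carriers both sides
    are undefined by extensionality.\<close>
  ultimately have "D = scalar_datum K V l' L' z"
    using ext unfolding D' scalar_datum_def prod.inject
    by (intro conjI extensionalityI[OF _ restrict_extensional]) auto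
  then show thesis using that T \<open>z \<in> Ker_diff V l' L'\<close> by blast
qed

text \<open>The triple is recovered from its datum by setting all scalars to one; extensionality
  then turns agreement on the carrier into equality of functions.\<close>

lemma scalar_datum_inj:
  assumes V: "vectorspace K V" and eq: "scalar_datum K V l L z = scalar_datum K V l' L' z'"
    and T: "(l, L) \<in> T_pairs K V" "(l', L') \<in> T_pairs K V" and z: "z \<in> carrier V" "z' \<in> carrier V"
  shows "l = l' \<and> L = L' \<and> z = z'"
proof -
  interpret V: vectorspace K V by fact
  have h: "l x \<in> carrier V" "L x \<in> carrier V" "l' x \<in> carrier V" "L' x \<in> carrier V" if "x \<in> carrier V" for x
    using that T_pairs_D(1,2)[OF T(1)] T_pairs_D(1,2)[OF T(2)] by (auto simp: module_hom_def)
  have "l x = l' x" "L x = L' x" if "x \<in> carrier V" for x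
    using that h[OF that] arg_cong[OF eq, of "\<lambda>D. fst D (x, \<one>\<^bsub>K\<^esub>)"]
      arg_cong[OF eq, of "\<lambda>D. fst (snd D) (\<one>\<^bsub>K\<^esub>, x)"]
    by (simp_all add: scalar_datum_def)
  moreover have "z = z'"
    using z arg_cong[OF eq, of "\<lambda>D. snd (snd D) (\<one>\<^bsub>K\<^esub>, \<one>\<^bsub>K\<^esub>)"] by (simp add: scalar_datum_def)
  ultimately show ?thesis
    using T_pairs_D(3,4)[OF T(1)] T_pairs_D(3,4)[OF T(2)] by (auto intro: extensionalityI)
qed

lemma bij_betw_scalar_datum:
  assumes K: "field K" and V: "vectorspace K V"
  shows "bij_betw (\<lambda>(l, L, z). scalar_datum K V l L z)
       {(l, L, z). (l, L) \<in> T_pairs K V \<and> z \<in> Ker_diff V l L} (Met K (self_space K) V)"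
  unfolding bij_betw_def
proof (intro conjI equalityI subsetI)
  show "inj_on (\<lambda>(l, L, z). scalar_datum K V l L z)
       {(l, L, z). (l, L) \<in> T_pairs K V \<and> z \<in> Ker_diff V l L}"
    using scalar_datum_inj[OF V] mem_Ker_diff_iff[OF V] by (auto simp: inj_on_def)
next
  fix D assume "D \<in> Met K (self_space K) V"
  then show "D \<in> (\<lambda>(l, L, z). scalar_datum K V l L z) ` {(l, L, z). (l, L) \<in> T_pairs K V \<and> z \<in> Ker_diff V l L}"
    by (rule Met_scalar_datum[OF K V]) force
qed (auto intro: scalar_datum_Met[OF K V])

lemma k_star_simps [simp]:
  "carrier (k_star K V l L z) = carrier K \<times> carrier V"
  "zero (k_star K V l L z) = (\<zero>\<^bsub>K\<^esub>, \<zero>\<^bsub>V\<^esub>)"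
  "(p, x) \<oplus>\<^bsub>k_star K V l L z\<^esub> (q, y) = (p \<oplus>\<^bsub>K\<^esub> q, x \<oplus>\<^bsub>V\<^esub> y)"
  "c \<odot>\<^bsub>k_star K V l L z\<^esub> (p, x) = (c \<otimes>\<^bsub>K\<^esub> p, c \<odot>\<^bsub>V\<^esub> x)"
  by (simp_all add: k_star_def)

lemma k_star_mult:
  assumes "p \<in> carrier K" "q \<in> carrier K" "x \<in> carrier V" "y \<in> carrier V"
  shows "(p, x) \<otimes>\<^bsub>k_star K V l L z\<^esub> (q, y) =
    (\<zero>\<^bsub>K\<^esub>, (p \<otimes>\<^bsub>K\<^esub> q) \<odot>\<^bsub>V\<^esub> z \<oplus>\<^bsub>V\<^esub> p \<odot>\<^bsub>V\<^esub> L y \<oplus>\<^bsub>V\<^esub> q \<odot>\<^bsub>V\<^esub> l x)"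
  using assms by (simp add: k_star_def scalar_datum_def)

abbreviation (input) k_star_ext where
  "k_star_ext K V l L z \<equiv> (k_star K V l L z, (\<lambda>x. (\<zero>\<^bsub>K\<^esub>, x)), fst)"

lemma k_star_extension:
  assumes "field K" and "vectorspace K V" and "(l, L) \<in> T_pairs K V" and "z \<in> Ker_diff V l L"
  shows "is_extension K (trivial_alg (self_space K)) (trivial_alg V) (k_star_ext K V l L z)"
  using met_prod_extension[OF self_space_vectorspace[OF assms(1)] assms(2) scalar_datum_Met[OF assms]]
  by (simp add: k_star_def)

section \<open>Extensions of a line by an abelian algebra\<close>

text \<open>The morphism is \<open>(p, x) \<mapsto> p a + i x\<close>; the conditions on
  \<open>a\<close> are what makes it multiplicative. It is used both to bring an arbitrary extension
  to normal form and, with a metabelian product as target, to compare two normal forms.\<close>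

lemma k_star_ext_equivI:
  assumes K: "field K" and V: "vectorspace K V"
    and E: "is_extension K (trivial_alg (self_space K)) (trivial_alg V) (A, i, \<pi>)"
    and T: "(l, L) \<in> T_pairs K V" and z: "z \<in> carrier V"
    and a: "a \<in> carrier A" "\<pi> a = \<one>\<^bsub>K\<^esub>" "a \<otimes>\<^bsub>A\<^esub> a = i z"
    and lL: "\<And>x. x \<in> carrier V \<Longrightarrow> i (l x) = i x \<otimes>\<^bsub>A\<^esub> a" "\<And>x. x \<in> carrier V \<Longrightarrow> i (L x) = a \<otimes>\<^bsub>A\<^esub> i x"
  shows "ext_equiv K (trivial_alg (self_space K)) (trivial_alg V) (k_star_ext K V l L z) (A, i, \<pi>)"
proof -
  interpret K: field K by fact
  interpret V: vectorspace K V by fact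
  interpret A: assoc_algebra K A using E by (simp add: is_extension_def)
  note AE = A.assoc_algebra_axioms[unfolded assoc_algebra_alt]
  have i: "i \<in> alg_hom K (trivial_alg V) A" and p: "\<pi> \<in> alg_hom K A (trivial_alg (self_space K))"
    and ker: "i ` carrier V = a_kernel A (trivial_alg (self_space K)) \<pi>"
    using E by (auto simp: is_extension_def)
  note iD = alg_hom_D[OF i, simplified] and pD = alg_hom_D[OF p, simplified]
  have i0: "i \<zero>\<^bsub>V\<^esub> = \<zero>\<^bsub>A\<^esub>"
    using module_hom_zero[OF trivial_alg_assoc_algebra[OF V, THEN assoc_algebra.axioms(1)] A.vectorspace_axioms, of i] i
    by (simp add: alg_hom_def)
  have pi: "\<pi> (i x) = \<zero>\<^bsub>K\<^esub>" if "x \<in> carrier V" for x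
  proof -
    have "i x \<in> a_kernel A (trivial_alg (self_space K)) \<pi>" using that ker by blast
    then show ?thesis by (simp add: a_kernel_def')
  qed
  have hl: "l x \<in> carrier V" "L x \<in> carrier V" if "x \<in> carrier V" for x
    using that T_pairs_D(1,2)[OF T] by (auto simp: module_hom_def)
  define f where "f = (\<lambda>(p, x). p \<odot>\<^bsub>A\<^esub> a \<oplus>\<^bsub>A\<^esub> i x)"
  have "f \<in> alg_hom K (k_star K V l L z) A"
  proof (intro alg_homI module_homI)
    fix u v assume u: "u \<in> carrier (k_star K V l L z)" and v: "v \<in> carrier (k_star K V l L z)"
    obtain p x where u': "u = (p, x)" by (cases u)
    obtain q y where v': "v = (q, y)" by (cases v)
    have c: "p \<in> carrier K" "q \<in> carrier K" "x \<in> carrier V" "y \<in> carrier V" using u v u' v' by auto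
    show "f (u \<oplus>\<^bsub>k_star K V l L z\<^esub> v) = f u \<oplus>\<^bsub>A\<^esub> f v"
      using c a by (simp add: f_def u' v' iD A.smult_l_distr A.M.a_ac)
    have "f (u \<otimes>\<^bsub>k_star K V l L z\<^esub> v)
        = (p \<otimes>\<^bsub>K\<^esub> q) \<odot>\<^bsub>A\<^esub> (a \<otimes>\<^bsub>A\<^esub> a) \<oplus>\<^bsub>A\<^esub> p \<odot>\<^bsub>A\<^esub> (a \<otimes>\<^bsub>A\<^esub> i y) \<oplus>\<^bsub>A\<^esub> q \<odot>\<^bsub>A\<^esub> (i x \<otimes>\<^bsub>A\<^esub> a)"
      using c a z by (simp add: f_def u' v' k_star_mult iD hl lL[symmetric])
    \<comment> \<open>Expanding the right-hand side gives one further term \<open>i x\<close> times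
      \<open>i y\<close>, which is zero because \<open>i\<close> is multiplicative on a trivial
      algebra.\<close>
    also have "\<dots> = (p \<odot>\<^bsub>A\<^esub> a \<oplus>\<^bsub>A\<^esub> i x) \<otimes>\<^bsub>A\<^esub> (q \<odot>\<^bsub>A\<^esub> a \<oplus>\<^bsub>A\<^esub> i y)"
      using c a(1) AE
      by (simp add: iD iD(4)[symmetric] i0 A.smult_r_distr A.smult_assoc1[symmetric] K.m_comm A.M.a_ac)
    also have "\<dots> = f u \<otimes>\<^bsub>A\<^esub> f v" by (simp add: f_def u' v')
    finally show "f (u \<otimes>\<^bsub>k_star K V l L z\<^esub> v) = f u \<otimes>\<^bsub>A\<^esub> f v" .
  qed (use a in \<open>auto simp: f_def iD A.smult_r_distr A.smult_assoc1\<close>)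
  then show ?thesis unfolding ext_equiv_def prod.case
    by (intro bexI[of _ f]) (use a in \<open>auto simp: f_def iD pD pi\<close>)
qed

text \<open>Surjectivity of the classification: a preimage \<open>a\<close> of one yields the
  triple, and all relations are checked inside \<open>A\<close>, where they are instances of
  associativity or of the vanishing of products in the kernel.\<close>

lemma extension_equiv_k_star:
  assumes K: "field K" and V: "vectorspace K V"
    and E: "is_extension K (trivial_alg (self_space K)) (trivial_alg V) E"
  obtains l L z where "(l, L) \<in> T_pairs K V" "z \<in> Ker_diff V l L"
    "ext_equiv K (trivial_alg (self_space K)) (trivial_alg V) (k_star_ext K V l L z) E"
proof -
  obtain A i \<pi> where E': "E = (A, i, \<pi>)" by (cases E)
  note E = E[unfolded E']
  interpret K: field K by fact
  interpret V: vectorspace K V by fact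
  interpret A: assoc_algebra K A using E by (simp add: is_extension_def)
  note AE = A.assoc_algebra_axioms[unfolded assoc_algebra_alt]
  have i: "i \<in> alg_hom K (trivial_alg V) A" and p: "\<pi> \<in> alg_hom K A (trivial_alg (self_space K))"
    and ker: "i ` carrier V = a_kernel A (trivial_alg (self_space K)) \<pi>"
    and sur: "\<pi> ` carrier A = carrier K" and inj: "inj_on i (carrier V)"
    using E by (auto simp: is_extension_def)
  note iD = alg_hom_D[OF i, simplified] and pD = alg_hom_D[OF p, simplified]
  have "\<one>\<^bsub>K\<^esub> \<in> \<pi> ` carrier A" using sur by simp
  then obtain a where a: "a \<in> carrier A" "\<pi> a = \<one>\<^bsub>K\<^esub>" by auto
  have i0: "i \<zero>\<^bsub>V\<^esub> = \<zero>\<^bsub>A\<^esub>"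
    using module_hom_zero[OF trivial_alg_assoc_algebra[OF V, THEN assoc_algebra.axioms(1)] A.vectorspace_axioms, of i] i
    by (simp add: alg_hom_def)
  define g where "g = inv_into (carrier V) i"
  \<comment> \<open>Products in \<open>A\<close> map to zero in the trivial quotient, so by
    exactness they come from \<open>V\<close>, and \<open>g\<close> pulls them back.\<close>
  have g: "g (x \<otimes>\<^bsub>A\<^esub> y) \<in> carrier V" "i (g (x \<otimes>\<^bsub>A\<^esub> y)) = x \<otimes>\<^bsub>A\<^esub> y"
    if "x \<in> carrier A" "y \<in> carrier A" for x y
  proof -
    have "x \<otimes>\<^bsub>A\<^esub> y \<in> i ` carrier V"
      unfolding ker using that pD AE by (simp add: a_kernel_def')
    then show "g (x \<otimes>\<^bsub>A\<^esub> y) \<in> carrier V" "i (g (x \<otimes>\<^bsub>A\<^esub> y)) = x \<otimes>\<^bsub>A\<^esub> y"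
      unfolding g_def by (auto simp: inv_into_into f_inv_into_f)
  qed
  define l where "l = restrict (\<lambda>x. g (i x \<otimes>\<^bsub>A\<^esub> a)) (carrier V)"
  define L where "L = restrict (\<lambda>x. g (a \<otimes>\<^bsub>A\<^esub> i x)) (carrier V)"
  define z where "z = g (a \<otimes>\<^bsub>A\<^esub> a)"
  have lc: "l x \<in> carrier V" "L x \<in> carrier V" if "x \<in> carrier V" for x
    using that a by (simp_all add: l_def L_def g iD)
  have il: "i (l x) = i x \<otimes>\<^bsub>A\<^esub> a" "i (L x) = a \<otimes>\<^bsub>A\<^esub> i x" if "x \<in> carrier V" for x
    using that a by (simp_all add: l_def L_def g iD)
  have z: "z \<in> carrier V" "i z = a \<otimes>\<^bsub>A\<^esub> a" using a by (simp_all add: z_def g)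
  \<comment> \<open>Identities in \<open>V\<close> are verified in \<open>A\<close>, after applying
    the injective map \<open>i\<close>.\<close>
  have eqI: "x = y" if "i x = i y" "x \<in> carrier V" "y \<in> carrier V" for x y
    using inj that by (auto dest: inj_onD)
  have T: "(l, L) \<in> T_pairs K V"
    unfolding T_pairs_def End_space_def
  proof (safe intro!: module_homI)
    fix x y assume xy: "x \<in> carrier V" "y \<in> carrier V"
    show "l (x \<oplus>\<^bsub>V\<^esub> y) = l x \<oplus>\<^bsub>V\<^esub> l y" "L (x \<oplus>\<^bsub>V\<^esub> y) = L x \<oplus>\<^bsub>V\<^esub> L y"
      by (rule eqI; use xy a AE in \<open>simp add: il lc iD\<close>)+
  next
    fix c x assume xy: "x \<in> carrier V" "c \<in> carrier K"
    show "l (c \<odot>\<^bsub>V\<^esub> x) = c \<odot>\<^bsub>V\<^esub> l x" "L (c \<odot>\<^bsub>V\<^esub> x) = c \<odot>\<^bsub>V\<^esub> L x"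
      by (rule eqI; use xy a AE in \<open>simp add: il lc iD\<close>)+
  next
    fix x assume x: "x \<in> carrier V"
    \<comment> \<open>This gives the square-zero relations: acting twice by \<open>a\<close> is the
      same as multiplying by \<open>a\<close> squared, which is \<open>i z\<close>, and products of
      kernel elements vanish.\<close>
    have "i x \<otimes>\<^bsub>A\<^esub> i z = \<zero>\<^bsub>A\<^esub>" "i z \<otimes>\<^bsub>A\<^esub> i x = \<zero>\<^bsub>A\<^esub>"
      using x z(1) by (simp_all add: iD(4)[symmetric] i0)
    then show "l (l x) = \<zero>\<^bsub>V\<^esub>" "L (L x) = \<zero>\<^bsub>V\<^esub>"
      using x a AE iD(1)[OF x] by (auto intro!: eqI simp: il lc i0 z(2))
    show "L (l x) = l (L x)"
      by (rule eqI) (use x a AE in \<open>simp_all add: il lc iD\<close>)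
  qed (auto simp: l_def L_def g iD a)
  \<comment> \<open>Under \<open>i\<close> this is the associativity of the cube of
    \<open>a\<close>.\<close>
  have "L z = l z"
    by (rule eqI) (use z a AE in \<open>simp_all add: il lc\<close>)
  then have "z \<in> Ker_diff V l L" using z mem_Ker_diff_iff[OF V T] by simp
  moreover have "ext_equiv K (trivial_alg (self_space K)) (trivial_alg V) (k_star_ext K V l L z) E"
    unfolding E' by (rule k_star_ext_equivI[OF K V E T z(1) a z(2)[symmetric] il])
  ultimately show thesis using that T by blast
qed

section \<open>Cosets of Im(\<Lambda> + \<lambda>) and the classification of extensions\<close>

text \<open>Negation is multiplication by minus one. This gives submodules access to the coset
  lemmas for subgroups.\<close>

lemma submodule_additive_subgroup:
  assumes "submodule K U V" shows "additive_subgroup U V"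
proof -
  interpret U: submodule K U V by fact
  interpret V: module K V by (rule U.module)
  have "\<ominus>\<^bsub>V\<^esub> u \<in> U" if "u \<in> U" for u
  proof -
    have u: "u \<in> carrier V" using that U.subset by blast
    have "(\<ominus>\<^bsub>K\<^esub> \<one>\<^bsub>K\<^esub>) \<odot>\<^bsub>V\<^esub> u \<in> U" using that by (intro U.smult_closed) auto
    then show ?thesis using u by (simp add: V.smult_l_minus)
  qed
  then show ?thesis
    by (intro additive_subgroup.intro V.add.subgroupI)
       (use U.subset U.zero_closed in \<open>force simp: a_inv_def\<close>)+
qed

lemma Im_sum_coset_eq_iff:
  assumes V: "vectorspace K V" and T: "(l, L) \<in> T_pairs K V" and z: "z \<in> carrier V" "z' \<in> carrier V"
  shows "Im_sum V l L +>\<^bsub>V\<^esub> z = Im_sum V l L +>\<^bsub>V\<^esub> z' \<longleftrightarrow>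
    (\<exists>v\<in>carrier V. z = L v \<oplus>\<^bsub>V\<^esub> l v \<oplus>\<^bsub>V\<^esub> z')"
proof -
  interpret V: vectorspace K V by fact
  have hom: "(\<lambda>x. L x \<oplus>\<^bsub>V\<^esub> l x) \<in> module_hom K V V"
    using T_pairs_D(1,2)[OF T]
    by (auto simp: module_hom_def Pi_iff V.M.a_ac V.smult_r_distr)
  interpret S: mod_hom K V V "\<lambda>x. L x \<oplus>\<^bsub>V\<^esub> l x" using hom by unfold_locales
  have I: "Im_sum V l L = S.im" by (simp add: Im_sum_def S.im_def)
  have sub: "subgroup S.im (add_monoid V)"
    using submodule_additive_subgroup[OF S.im_is_submodule] by (simp add: additive_subgroup_def)
  have "\<zero>\<^bsub>V\<^esub> \<in> S.im" using S.im_is_submodule by (rule submodule.zero_closed)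
  then have self: "z \<in> S.im +>\<^bsub>V\<^esub> z"
    using z by (force simp: a_r_coset_def')
  have "S.im +>\<^bsub>V\<^esub> z = S.im +>\<^bsub>V\<^esub> z' \<longleftrightarrow> z \<in> S.im +>\<^bsub>V\<^esub> z'"
    using self V.M.a_repr_independence[OF _ z(2) sub] by blast
  also have "\<dots> \<longleftrightarrow> (\<exists>v\<in>carrier V. z = L v \<oplus>\<^bsub>V\<^esub> l v \<oplus>\<^bsub>V\<^esub> z')"
    by (auto simp: a_r_coset_def' S.im_def)
  finally show ?thesis by (simp add: I)
qed

text \<open>A morphism fixing both ends is determined by the vector \<open>v\<close> with
  \<open>f (1, 0) = (1, v)\<close>. Multiplicativity on products of \<open>(1, 0)\<close> with
  \<open>(0, x)\<close> forces equal pairs of endomorphisms, and on the square of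
  \<open>(1, 0)\<close> it says that \<open>z\<close> and \<open>z'\<close> differ by
  \<open>L' v + l' v\<close>.\<close>

lemma k_star_ext_equiv_iff:
  assumes K: "field K" and V: "vectorspace K V"
    and T: "(l, L) \<in> T_pairs K V" "(l', L') \<in> T_pairs K V"
    and z: "z \<in> Ker_diff V l L" "z' \<in> Ker_diff V l' L'"
  shows "ext_equiv K (trivial_alg (self_space K)) (trivial_alg V)
      (k_star_ext K V l L z) (k_star_ext K V l' L' z') \<longleftrightarrow>
    l = l' \<and> L = L' \<and> Im_sum V l L +>\<^bsub>V\<^esub> z = Im_sum V l' L' +>\<^bsub>V\<^esub> z'"
    (is "?E \<longleftrightarrow> ?R")
proof -
  interpret K: field K by fact
  interpret V: vectorspace K V by fact
  have zV: "z \<in> carrier V" "z' \<in> carrier V" using z T mem_Ker_diff_iff[OF V] by auto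
  note TD = T_pairs_D[OF T(1)] and TD' = T_pairs_D[OF T(2)]
  have hc: "l x \<in> carrier V" "L x \<in> carrier V" "l' x \<in> carrier V" "L' x \<in> carrier V" if "x \<in> carrier V" for x
    using that TD(1,2) TD'(1,2) by (auto simp: module_hom_def)
  have h0: "l \<zero>\<^bsub>V\<^esub> = \<zero>\<^bsub>V\<^esub>" "L \<zero>\<^bsub>V\<^esub> = \<zero>\<^bsub>V\<^esub>" "l' \<zero>\<^bsub>V\<^esub> = \<zero>\<^bsub>V\<^esub>" "L' \<zero>\<^bsub>V\<^esub> = \<zero>\<^bsub>V\<^esub>"
    using module_hom_zero[OF V V] TD(1,2) TD'(1,2) by auto
  show ?thesis
  proof
    assume ?E
    then obtain f where f: "f \<in> alg_hom K (k_star K V l L z) (k_star K V l' L' z')"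
      and fi: "\<And>x. x \<in> carrier V \<Longrightarrow> f (\<zero>\<^bsub>K\<^esub>, x) = (\<zero>\<^bsub>K\<^esub>, x)"
      and fp: "\<And>p x. p \<in> carrier K \<Longrightarrow> x \<in> carrier V \<Longrightarrow> fst (f (p, x)) = p"
      by (auto simp: ext_equiv_def)
    note fm = alg_hom_D(4)[OF f]
    define v where "v = snd (f (\<one>\<^bsub>K\<^esub>, \<zero>\<^bsub>V\<^esub>))"
    have f1: "f (\<one>\<^bsub>K\<^esub>, \<zero>\<^bsub>V\<^esub>) = (\<one>\<^bsub>K\<^esub>, v)" using fp[of "\<one>\<^bsub>K\<^esub>" "\<zero>\<^bsub>V\<^esub>"] by (simp add: v_def prod_eq_iff)
    have v: "v \<in> carrier V" using alg_hom_D(1)[OF f, of "(\<one>\<^bsub>K\<^esub>, \<zero>\<^bsub>V\<^esub>)"] f1 by simp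
    have "l x = l' x" "L x = L' x" if x: "x \<in> carrier V" for x
      using fm[of "(\<zero>\<^bsub>K\<^esub>, x)" "(\<one>\<^bsub>K\<^esub>, \<zero>\<^bsub>V\<^esub>)"] fm[of "(\<one>\<^bsub>K\<^esub>, \<zero>\<^bsub>V\<^esub>)" "(\<zero>\<^bsub>K\<^esub>, x)"] x v zV
      by (simp_all add: k_star_mult fi f1 hc h0)
    then have lL: "l = l'" "L = L'" using TD(3,4) TD'(3,4) by (auto intro: extensionalityI)
    \<comment> \<open>The square of \<open>(1, 0)\<close> is \<open>(0, z)\<close>, which
      \<open>f\<close> fixes, while the square of its image \<open>(1, v)\<close> is
      \<open>(0, z' + L' v + l' v)\<close>.\<close>
    have "z = L' v \<oplus>\<^bsub>V\<^esub> l' v \<oplus>\<^bsub>V\<^esub> z'"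
      using fm[of "(\<one>\<^bsub>K\<^esub>, \<zero>\<^bsub>V\<^esub>)" "(\<one>\<^bsub>K\<^esub>, \<zero>\<^bsub>V\<^esub>)"] v zV
      by (simp add: k_star_mult fi f1 hc h0 V.M.a_ac)
    then show ?R using lL v Im_sum_coset_eq_iff[OF V T(2) zV] by auto
  next
    assume ?R
    then obtain v where lL: "l = l'" "L = L'" and v: "v \<in> carrier V" "z = L' v \<oplus>\<^bsub>V\<^esub> l' v \<oplus>\<^bsub>V\<^esub> z'"
      using Im_sum_coset_eq_iff[OF V T(2) zV] by auto
    show ?E
      \<comment> \<open>In the target, \<open>(1, v)\<close> lies over one, has square
        \<open>(0, z)\<close>, and multiplies the kernel in the same way as
        \<open>(1, 0)\<close>.\<close>
      by (rule k_star_ext_equivI[OF K V k_star_extension[OF K V T(2) z(2)] T(1) zV(1), of "(\<one>\<^bsub>K\<^esub>, v)"])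
         (use v zV lL in \<open>auto simp: k_star_mult hc h0 V.M.a_ac\<close>)
  qed
qed

lemma carrier_quot_space:
  "carrier (quot_space V U) = {U +>\<^bsub>V\<^esub> x | x. x \<in> carrier V}"
  by (auto simp: quot_space_def A_RCOSETS_def' a_r_coset_def')

text \<open>The injection \<open>j\<close> lets every metabelian product be copied into the type
  \<open>'e\<close>, so that its class there is nonempty. Injectivity of the map is then the
  comparison of normal forms, and surjectivity is their existence.\<close>

lemma Ext_bij:
  fixes K :: "('k, 'r) ring_scheme" and V :: "('k, 'v) module" and j :: "'k \<times> 'v \<Rightarrow> 'e"
  assumes K: "field K" and V: "vectorspace K V" and j: "inj_on j (carrier K \<times> carrier V)"
  obtains f where "bij_betw f
             (SIGMA (l, L) : T_pairs K V.
                carrier (quot_space (V\<lparr>carrier := Ker_diff V l L\<rparr>) (Im_sum V l L)))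
             (Ext K (trivial_alg (self_space K)) (trivial_alg V) :: ('k, 'v, 'e, 'k) ext set set)"
    "\<And>l L z. (l, L) \<in> T_pairs K V \<Longrightarrow> z \<in> Ker_diff V l L \<Longrightarrow>
       f ((l, L), Im_sum V l L +>\<^bsub>V\<^esub> z) =
         ext_class K (trivial_alg (self_space K)) (trivial_alg V) (k_star_ext K V l L z)"
proof -
  let ?Q = "trivial_alg (self_space K)" and ?V = "trivial_alg V"
  let ?S = "SIGMA (l, L) : T_pairs K V.
                carrier (quot_space (V\<lparr>carrier := Ker_diff V l L\<rparr>) (Im_sum V l L))"
  let ?cl = "\<lambda>l L z. ext_class K ?Q ?V (k_star_ext K V l L z) :: ('k, 'v, 'e, 'k) ext set"
  \<comment> \<open>Cosets depend only on the addition, so those formed in the kernel and those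
    formed in \<open>V\<close> are the same sets.\<close>
  have car: "carrier (quot_space (V\<lparr>carrier := Ker_diff V l L\<rparr>) (Im_sum V l L)) =
      {Im_sum V l L +>\<^bsub>V\<^esub> z | z. z \<in> Ker_diff V l L}" for l L
    by (simp add: carrier_quot_space a_r_coset_def')
  have cl_mem: "?cl l L z \<in> Ext K ?Q ?V \<and> ?cl l L z \<noteq> {}"
    and cl_eq: "?cl l L z = ?cl l' L' z' \<longleftrightarrow>
      l = l' \<and> L = L' \<and> Im_sum V l L +>\<^bsub>V\<^esub> z = Im_sum V l' L' +>\<^bsub>V\<^esub> z'"
    if T: "(l, L) \<in> T_pairs K V" "z \<in> Ker_diff V l L"
      and T': "(l', L') \<in> T_pairs K V" "z' \<in> Ker_diff V l' L'" for l L z l' L' z'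
  proof -
    note E = k_star_extension[OF K V T] and E' = k_star_extension[OF K V T']
    define h where "h = inv_into (carrier K \<times> carrier V) j"
    have h: "h (j a) = a" if "a \<in> carrier (k_star K V l L z)" for a
      using j that by (simp add: h_def)
    note G = is_extension_transport[where j = j and h = h, OF E h]
    note eq = ext_class_eq_iff[OF E _ G]
    show "?cl l L z = ?cl l' L' z' \<longleftrightarrow>
      l = l' \<and> L = L' \<and> Im_sum V l L +>\<^bsub>V\<^esub> z = Im_sum V l' L' +>\<^bsub>V\<^esub> z'"
      by (rule trans[OF eq[OF E'] k_star_ext_equiv_iff[OF K V T(1) T'(1) T(2) T'(2)]])
    show "?cl l L z \<in> Ext K ?Q ?V \<and> ?cl l L z \<noteq> {}"
      unfolding Ext_eq_image using eq[OF G(1)] G by (auto simp: ext_class_def[of K ?Q ?V "k_star_ext K V l L z"])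
  qed
  \<comment> \<open>The map picks a representative of the coset; by \<open>cl_eq\<close> the class
    does not depend on the choice.\<close>
  define f where "f = (\<lambda>((l, L), X). ?cl l L (SOME z. z \<in> Ker_diff V l L \<and> X = Im_sum V l L +>\<^bsub>V\<^esub> z))"
  have f: "f ((l, L), Im_sum V l L +>\<^bsub>V\<^esub> z) = ?cl l L z"
    if T: "(l, L) \<in> T_pairs K V" "z \<in> Ker_diff V l L" for l L z
  proof -
    define z' where "z' = (SOME z'. z' \<in> Ker_diff V l L \<and> Im_sum V l L +>\<^bsub>V\<^esub> z = Im_sum V l L +>\<^bsub>V\<^esub> z')"
    have z': "z' \<in> Ker_diff V l L \<and> Im_sum V l L +>\<^bsub>V\<^esub> z = Im_sum V l L +>\<^bsub>V\<^esub> z'"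
      unfolding z'_def using T(2) by (rule someI[where x = z, OF conjI]) simp
    have "f ((l, L), Im_sum V l L +>\<^bsub>V\<^esub> z) = ?cl l L z'" by (simp add: f_def z'_def)
    then show ?thesis using cl_eq[OF T(1) _ T, of z'] z' by simp
  qed
  have "bij_betw f ?S (Ext K ?Q ?V)"
    unfolding bij_betw_def
  proof (intro conjI equalityI subsetI)
    show "inj_on f ?S"
      unfolding car by (rule inj_onI) (clarsimp simp: f cl_eq)
  next
    fix X assume "X \<in> f ` ?S"
    then show "X \<in> Ext K ?Q ?V" using cl_mem unfolding car by (clarsimp simp: f)
  next
    fix X :: "('k, 'v, 'e, 'k) ext set" assume "X \<in> Ext K ?Q ?V"
    then obtain E :: "('k, 'v, 'e, 'k) ext" where E: "is_extension K ?Q ?V E" "X = ext_class K ?Q ?V E"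
      unfolding Ext_eq_image by blast
    obtain l L z where T: "(l, L) \<in> T_pairs K V" "z \<in> Ker_diff V l L"
      and eq: "ext_equiv K ?Q ?V (k_star_ext K V l L z) E"
      using extension_equiv_k_star[OF K V E(1)] .
    have "X = ?cl l L z"
      using ext_class_eq_iff[OF k_star_extension[OF K V T] E(1) E(1) eq] eq E(2) by simp
    then show "X \<in> f ` ?S"
      using f[OF T] T by (intro image_eqI[of _ _ "((l, L), Im_sum V l L +>\<^bsub>V\<^esub> z)"]) (auto simp: car)
  qed
  then show thesis using f by (rule that)
qed

section \<open>Derived algebras of codimension one\<close>

text \<open>If the coset of \<open>a\<close> is a basis of the quotient, each vector is
  \<open>u + c a\<close> with \<open>u\<close> in \<open>U\<close> and a unique scalar
  \<open>c\<close>; the functional reads off \<open>c\<close>.\<close>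

lemma codim_one_functional:
  assumes U: "subspace K U V" and cod: "has_codim K V U 1"
  obtains f where "f \<in> module_hom K V (self_space K)" "f ` carrier V = carrier K"
    "a_kernel V (self_space K) f = U"
proof -
  interpret V: vectorspace K V using U by (simp add: subspace_def)
  have sm: "submodule K U V" using U by (simp add: subspace_def)
  interpret U: submodule K U V by fact
  interpret Us: additive_subgroup U V using sm by (rule submodule_additive_subgroup)
  interpret Q: vectorspace K "quot_space V U" using U by (rule quot_space_vectorspace)
  have UV: "u \<in> carrier V" if "u \<in> U" for u using that U.subset by blast
  have "Q.fin_dim" "Q.dim = 1" using cod by (simp_all add: has_codim_def)
  then obtain B where B: "finite B" "Q.basis B" "card B = 1"
    using Q.finite_basis_exists Q.dim_basis by metis
  then obtain X where X: "B = {X}" by (auto simp: card_1_singleton_iff)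
  have Xc: "X \<in> carrier (quot_space V U)" and sp: "Q.span {X} = carrier (quot_space V U)"
    and li: "Q.lin_indpt {X}"
    using B(2) by (auto simp: Q.basis_def X)
  \<comment> \<open>In a field one differs from zero, so zero lies in no linearly independent set.
    Hence \<open>X\<close> is not the zero coset, and its representative \<open>a\<close> lies
    outside \<open>U\<close>.\<close>
  have "carrier K \<noteq> {\<zero>\<^bsub>K\<^esub>}" using V.R.one_closed V.one_not_zero by blast
  from Q.zero_nin_lin_indpt[OF _ li this] have "\<zero>\<^bsub>quot_space V U\<^esub> \<notin> {X}"
    using Xc by simp
  then have XU: "X \<noteq> U" by (simp add: quot_space_def)
  obtain a where a: "a \<in> carrier V" "X = U +>\<^bsub>V\<^esub> a" using Xc by (auto simp: carrier_quot_space)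
  have aU: "a \<notin> U" using XU V.M.a_coset_join2[OF a(1) Us.a_subgroup] a by blast
  define R where "R x c \<longleftrightarrow> c \<in> carrier K \<and> (\<exists>u\<in>U. x = u \<oplus>\<^bsub>V\<^esub> c \<odot>\<^bsub>V\<^esub> a)" for x c
  have R_ex: "\<exists>c. R x c" if x: "x \<in> carrier V" for x
  proof -
    have "U +>\<^bsub>V\<^esub> x \<in> Q.span {X}" using x by (auto simp: sp carrier_quot_space)
    then obtain b where b: "b \<in> {X} \<rightarrow> carrier K" "Q.lincomb b {X} = U +>\<^bsub>V\<^esub> x"
      using Q.finite_in_span[of "{X}"] Xc by blast
    define c where "c = b X"
    have c: "c \<in> carrier K" using b by (simp add: c_def)
    have "Q.lincomb b {X} = c \<odot>\<^bsub>quot_space V U\<^esub> X"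
      using Xc c by (simp add: Q.lincomb_def c_def)
    moreover have "x \<in> U +>\<^bsub>V\<^esub> x" using x U.zero_closed by (force simp: a_r_coset_def')
    \<comment> \<open>Scalar multiplication in \<open>quot_space\<close> is a union over
      representatives, so \<open>x\<close> lies in the coset of \<open>c y\<close> for some
      \<open>y\<close> congruent to \<open>a\<close>, not for \<open>a\<close> itself; the two
      corrections from \<open>U\<close> are merged below.\<close>
    ultimately obtain y where y: "y \<in> X" "x \<in> U +>\<^bsub>V\<^esub> (c \<odot>\<^bsub>V\<^esub> y)"
      using b(2) by (auto simp: quot_space_def)
    obtain u where u: "u \<in> U" "y = u \<oplus>\<^bsub>V\<^esub> a" using y a by (auto simp: a_r_coset_def')
    obtain w where w: "w \<in> U" "x = w \<oplus>\<^bsub>V\<^esub> c \<odot>\<^bsub>V\<^esub> y" using y by (auto simp: a_r_coset_def')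
    have "x = (w \<oplus>\<^bsub>V\<^esub> c \<odot>\<^bsub>V\<^esub> u) \<oplus>\<^bsub>V\<^esub> c \<odot>\<^bsub>V\<^esub> a"
      using w u a c by (simp add: UV V.smult_r_distr V.M.a_assoc)
    moreover have "w \<oplus>\<^bsub>V\<^esub> c \<odot>\<^bsub>V\<^esub> u \<in> U" using w u c by blast
    ultimately show ?thesis using c unfolding R_def by blast
  qed
  have R_add: "R (x \<oplus>\<^bsub>V\<^esub> y) (c \<oplus>\<^bsub>K\<^esub> d)" if xy: "R x c" "R y d" for x y c d
  proof -
    obtain u v where u: "u \<in> U" "x = u \<oplus>\<^bsub>V\<^esub> c \<odot>\<^bsub>V\<^esub> a" and v: "v \<in> U" "y = v \<oplus>\<^bsub>V\<^esub> d \<odot>\<^bsub>V\<^esub> a"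
      and cd: "c \<in> carrier K" "d \<in> carrier K"
      using xy by (auto simp: R_def)
    have "x \<oplus>\<^bsub>V\<^esub> y = (u \<oplus>\<^bsub>V\<^esub> v) \<oplus>\<^bsub>V\<^esub> (c \<oplus>\<^bsub>K\<^esub> d) \<odot>\<^bsub>V\<^esub> a"
      using u v cd a by (simp add: UV V.smult_l_distr V.M.a_ac)
    then show ?thesis using u v cd unfolding R_def by blast
  qed
  have R_smult: "R (k \<odot>\<^bsub>V\<^esub> x) (k \<otimes>\<^bsub>K\<^esub> c)" if x: "R x c" and k: "k \<in> carrier K" for x k c
  proof -
    obtain u where u: "u \<in> U" "x = u \<oplus>\<^bsub>V\<^esub> c \<odot>\<^bsub>V\<^esub> a" and c: "c \<in> carrier K"
      using x by (auto simp: R_def)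
    have "k \<odot>\<^bsub>V\<^esub> x = k \<odot>\<^bsub>V\<^esub> u \<oplus>\<^bsub>V\<^esub> (k \<otimes>\<^bsub>K\<^esub> c) \<odot>\<^bsub>V\<^esub> a"
      using u c a k by (simp add: UV V.smult_r_distr V.smult_assoc1)
    then show ?thesis using u c k unfolding R_def by blast
  qed
  have R_unique: "c = d" if xc: "R x c" and xd: "R x d" for x c d
  proof (rule ccontr)
    assume ne: "c \<noteq> d"
    have cd: "c \<in> carrier K" "d \<in> carrier K" using xc xd by (auto simp: R_def)
    have x: "x \<in> carrier V" using xc a by (auto simp: R_def UV)
    define e where "e = c \<ominus>\<^bsub>K\<^esub> d"
    have e: "e \<in> carrier K" "e \<noteq> \<zero>\<^bsub>K\<^esub>" using cd ne by (auto simp: e_def)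
    \<comment> \<open>Subtracting the two decompositions represents zero with the nonzero
      coefficient \<open>e\<close>; dividing by \<open>e\<close> gives \<open>0 = u + a\<close>,
      which would put \<open>a\<close> into \<open>U\<close>.\<close>
    have "R (x \<oplus>\<^bsub>V\<^esub> (\<ominus>\<^bsub>K\<^esub> \<one>\<^bsub>K\<^esub>) \<odot>\<^bsub>V\<^esub> x) (c \<oplus>\<^bsub>K\<^esub> (\<ominus>\<^bsub>K\<^esub> \<one>\<^bsub>K\<^esub>) \<otimes>\<^bsub>K\<^esub> d)"
      using R_add[OF xc R_smult[OF xd]] by simp
    then have "R \<zero>\<^bsub>V\<^esub> e"
      using x cd by (simp add: V.smult_l_minus V.M.r_neg V.R.l_minus e_def V.R.minus_eq)
    then have "R (inv\<^bsub>K\<^esub> e \<odot>\<^bsub>V\<^esub> \<zero>\<^bsub>V\<^esub>) (inv\<^bsub>K\<^esub> e \<otimes>\<^bsub>K\<^esub> e)"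
      using e V.field_Units by (intro R_smult) auto
    then have "R \<zero>\<^bsub>V\<^esub> \<one>\<^bsub>K\<^esub>" using e V.field_Units by simp
    then obtain u where u: "u \<in> U" "\<zero>\<^bsub>V\<^esub> = u \<oplus>\<^bsub>V\<^esub> a" using a by (auto simp: R_def)
    then have "\<ominus>\<^bsub>V\<^esub> a = u" using a UV by (intro V.M.minus_equality) simp_all
    then have "a = \<ominus>\<^bsub>V\<^esub> u" using a by auto
    then show False using aU u by simp
  qed
  define f where "f x = (SOME c. R x c)" for x
  have Rf: "R x (f x)" if "x \<in> carrier V" for x
    using someI_ex[OF R_ex[OF that]] by (simp add: f_def)
  have fI: "f x = c" if "R x c" for x c
  proof -
    have "x \<in> carrier V" using that a by (auto simp: R_def UV)
    then show ?thesis using that Rf R_unique by blast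
  qed
  show thesis
  proof (rule that)
    show "f \<in> module_hom K V (self_space K)"
      using Rf by (intro module_homI) (auto intro!: fI R_add R_smult simp: R_def)
    have Rc: "R (c \<odot>\<^bsub>V\<^esub> a) c" if "c \<in> carrier K" for c
      using that a by (auto simp: R_def intro!: bexI[of _ "\<zero>\<^bsub>V\<^esub>"])
    show "f ` carrier V = carrier K"
    proof (intro equalityI subsetI)
      fix c assume c: "c \<in> carrier K"
      then show "c \<in> f ` carrier V" using fI[OF Rc[OF c]] a by (intro image_eqI[of _ _ "c \<odot>\<^bsub>V\<^esub> a"]) auto
    qed (use Rf in \<open>auto simp: R_def\<close>)
    show "a_kernel V (self_space K) f = U"
    proof (intro equalityI subsetI)
      fix x assume "x \<in> a_kernel V (self_space K) f"
      then have "x \<in> carrier V" "f x = \<zero>\<^bsub>K\<^esub>" by (auto simp: a_kernel_def')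
      then have "R x \<zero>\<^bsub>K\<^esub>" using Rf by metis
      then show "x \<in> U" using a by (auto simp: R_def UV)
    next
      fix x assume "x \<in> U"
      then show "x \<in> a_kernel V (self_space K) f"
        using a by (auto simp: a_kernel_def' UV R_def intro!: fI bexI[of _ x])
    qed
  qed
qed

text \<open>The space \<open>W\<close> is the derived algebra rather than the given kernel, which
  may be larger. It still has zero products, and codimension one presents the quotient as the
  line.\<close>

lemma metabelian_codim_one:
  fixes A :: "('k, 'b) module"
  assumes met: "metabelian K A" and cod: "has_codim K A (derived_alg K A) 1"
  obtains W :: "('k, 'b) module" and l L z where "vectorspace K W" "(l, L) \<in> T_pairs K W"
    "z \<in> Ker_diff W l L" "alg_isomorphic K A (k_star K W l L z)"
proof -
  obtain Q :: "('k, 'b set) module" and V :: "('k, 'b) module" and i \<pi>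
    where E: "is_extension K Q V (A, i, \<pi>)" and ab: "abelian_alg Q" "abelian_alg V"
    using met by (auto simp: metabelian_def)
  interpret A: assoc_algebra K A using E by (simp add: is_extension_def)
  interpret Q: assoc_algebra K Q using E by (simp add: is_extension_def)
  interpret V: assoc_algebra K V using E by (simp add: is_extension_def)
  have i: "i \<in> alg_hom K V A" and p: "\<pi> \<in> alg_hom K A Q"
    and ker: "i ` carrier V = a_kernel A Q \<pi>"
    using E by (auto simp: is_extension_def)
  interpret p: mod_hom K A Q \<pi> using p by unfold_locales (simp add: alg_hom_def)
  note AE = A.assoc_algebra_axioms[unfolded assoc_algebra_alt]
  define P where "P = {x \<otimes>\<^bsub>A\<^esub> y | x y. x \<in> carrier A \<and> y \<in> carrier A}"
  define D where "D = derived_alg K A"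
  have D: "D = A.span P" by (simp add: D_def derived_alg_def P_def)
  have PA: "P \<subseteq> carrier A" using AE by (auto simp: P_def)
  have sub: "subspace K D A"
    using A.span_is_submodule[OF PA] A.vectorspace_axioms by (simp add: subspace_def D)
  have PD: "P \<subseteq> D" unfolding D by (rule A.in_own_span[OF PA])
  \<comment> \<open>Products vanish in the abelian quotient, so the derived algebra lies in the
    kernel of \<open>\<pi>\<close>, that is, in the image of the abelian algebra
    \<open>V\<close>.\<close>
  have "\<pi> (x \<otimes>\<^bsub>A\<^esub> y) = \<zero>\<^bsub>Q\<^esub>" if "x \<in> carrier A" "y \<in> carrier A" for x y
    using ab(1) that by (simp add: abelian_alg_def alg_hom_D(4)[OF p])
  then have "P \<subseteq> p.ker" using PA unfolding P_def p.ker_def by blast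
  then have "D \<subseteq> p.ker" unfolding D using p.ker_is_submodule by (rule A.span_is_subset)
  then have D_im: "D \<subseteq> i ` carrier V" unfolding ker by (auto simp: a_kernel_def' p.ker_def)
  have DD: "x \<otimes>\<^bsub>A\<^esub> y = \<zero>\<^bsub>A\<^esub>" if xy: "x \<in> D" "y \<in> D" for x y
  proof -
    obtain v w where v: "v \<in> carrier V" "x = i v" and w: "w \<in> carrier V" "y = i w"
      using xy D_im by blast
    have "x \<otimes>\<^bsub>A\<^esub> y = i (v \<otimes>\<^bsub>V\<^esub> w)" using v w by (simp add: alg_hom_D[OF i])
    also have "\<dots> = i \<zero>\<^bsub>V\<^esub>" using ab(2) v w by (simp add: abelian_alg_def)
    also have "\<dots> = \<zero>\<^bsub>A\<^esub>"
      using module_hom_zero[OF V.vectorspace_axioms A.vectorspace_axioms] i by (simp add: alg_hom_def)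
    finally show ?thesis .
  qed
  define W where "W = A\<lparr>carrier := D\<rparr>"
  have W: "vectorspace K W" unfolding W_def by (rule A.subspace_is_vs[OF sub])
  have DA: "x \<in> carrier A" if "x \<in> D" for x
    using that sub by (auto simp: subspace_def submodule_def)
  obtain f where f: "f \<in> module_hom K A (self_space K)" "f ` carrier A = carrier K"
    "a_kernel A (self_space K) f = D"
    using codim_one_functional[OF sub] cod D_def by blast
  have F: "is_extension K (trivial_alg (self_space K)) (trivial_alg W) (A, (\<lambda>x. x), f)"
    unfolding is_extension_def prod.case
  proof (intro conjI trivial_alg_assoc_algebra self_space_vectorspace W A.assoc_algebra_axioms)
    show "field K" by (rule A.field_axioms)
    show "(\<lambda>x. x) \<in> alg_hom K (trivial_alg W) A"
      by (intro alg_homI module_homI) (simp_all add: W_def DA DD)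
    \<comment> \<open>Every product lies in \<open>D\<close>, the kernel of \<open>f\<close>; this
      makes \<open>f\<close> multiplicative into the trivial algebra.\<close>
    have "f (x \<otimes>\<^bsub>A\<^esub> y) = \<zero>\<^bsub>K\<^esub>" if "x \<in> carrier A" "y \<in> carrier A" for x y
    proof -
      have "x \<otimes>\<^bsub>A\<^esub> y \<in> a_kernel A (self_space K) f" unfolding f(3) using PD that by (auto simp: P_def)
      then show ?thesis by (simp add: a_kernel_def')
    qed
    then show "f \<in> alg_hom K A (trivial_alg (self_space K))"
      using f(1) by (intro alg_homI) (simp_all add: module_hom_def)
    show "(\<lambda>x. x) ` carrier (trivial_alg W) = a_kernel A (trivial_alg (self_space K)) f"
      using f(3) by (simp add: W_def a_kernel_def')
  qed (use f in auto)
  obtain l L z where lL: "(l, L) \<in> T_pairs K W" and z: "z \<in> Ker_diff W l L"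
    and eq: "ext_equiv K (trivial_alg (self_space K)) (trivial_alg W) (k_star_ext K W l L z) (A, (\<lambda>x. x), f)"
    using extension_equiv_k_star[OF A.field_axioms W F] .
  have kE: "is_extension K (trivial_alg (self_space K)) (trivial_alg W) (k_star_ext K W l L z)"
    by (rule k_star_extension[OF A.field_axioms W lL z])
  \<comment> \<open>The equivalence is reversed because the isomorphism has to start at
    \<open>A\<close>.\<close>
  obtain g where g: "g \<in> alg_hom K A (k_star K W l L z)"
    "\<And>w. w \<in> carrier (trivial_alg W) \<Longrightarrow> g w = (\<zero>\<^bsub>K\<^esub>, w)" "\<And>a. a \<in> carrier A \<Longrightarrow> fst (g a) = f a"
    using ext_equiv_sym[OF kE F eq] by (auto simp: ext_equiv_def)
  have "bij_betw g (carrier A) (carrier (k_star K W l L z))"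
    by (rule ext_morphism_bij[OF F kE g(1)]) (rule g; assumption)+
  then have "alg_isomorphic K A (k_star K W l L z)"
    unfolding alg_isomorphic_def using g(1) by (rule bexI)
  then show thesis using W lL z by (intro that)
qed

section \<open>Data, extensions and algebras with derived algebra of codimension one
  together\<close>

theorem theorem2p11:
  fixes K :: "('k, 'r) ring_scheme" and V :: "('k, 'v) module"
  assumes "field K" and "vectorspace K V"
  shows
    "bij_betw (\<lambda>(l, L, z). scalar_datum K V l L z)
       {(l, L, z). (l, L) \<in> T_pairs K V \<and> z \<in> Ker_diff V l L}
       (Met K (self_space K) V)
     \<and>
     ((\<exists>j :: 'k \<times> 'v \<Rightarrow> 'e. inj_on j (carrier K \<times> carrier V)) \<longrightarrow>
      (\<exists>f. bij_betw f
             (SIGMA (l, L) : T_pairs K V.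
                carrier (quot_space (V\<lparr>carrier := Ker_diff V l L\<rparr>) (Im_sum V l L)))
             (Ext K (trivial_alg (self_space K)) (trivial_alg V) :: ('k, 'v, 'e, 'k) ext set set)
         \<and> (\<forall>(l, L) \<in> T_pairs K V. \<forall>z \<in> Ker_diff V l L.
              f ((l, L), Im_sum V l L +>\<^bsub>V\<^esub> z) =
                ext_class K (trivial_alg (self_space K)) (trivial_alg V)
                  (k_star K V l L z, (\<lambda>x. (\<zero>\<^bsub>K\<^esub>, x)), fst)
              \<and> (\<forall>p \<in> carrier K. \<forall>q \<in> carrier K. \<forall>x \<in> carrier V. \<forall>y \<in> carrier V.
                   (p, x) \<otimes>\<^bsub>k_star K V l L z\<^esub> (q, y) =
                     (\<zero>\<^bsub>K\<^esub>, (p \<otimes>\<^bsub>K\<^esub> q) \<odot>\<^bsub>V\<^esub> z \<oplus>\<^bsub>V\<^esub> p \<odot>\<^bsub>V\<^esub> L y \<oplus>\<^bsub>V\<^esub> q \<odot>\<^bsub>V\<^esub> l x)))))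
     \<and>
     (\<forall>A :: ('k, 'b) module.
        metabelian K A \<and> has_codim K A (derived_alg K A) 1 \<longrightarrow>
        (\<exists>(W :: ('k, 'b) module) l L z.
           vectorspace K W \<and> (l, L) \<in> T_pairs K W \<and> z \<in> Ker_diff W l L \<and>
           alg_isomorphic K A (k_star K W l L z)))"
proof (intro conjI impI allI)
  assume "\<exists>j :: 'k \<times> 'v \<Rightarrow> 'e. inj_on j (carrier K \<times> carrier V)"
  then obtain j :: "'k \<times> 'v \<Rightarrow> 'e" where "inj_on j (carrier K \<times> carrier V)" by blast
  from Ext_bij[OF assms this] obtain f where
    f: "bij_betw f (SIGMA (l, L) : T_pairs K V.
          carrier (quot_space (V\<lparr>carrier := Ker_diff V l L\<rparr>) (Im_sum V l L)))
        (Ext K (trivial_alg (self_space K)) (trivial_alg V) :: ('k, 'v, 'e, 'k) ext set set)"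
      "\<And>l L z. (l, L) \<in> T_pairs K V \<Longrightarrow> z \<in> Ker_diff V l L \<Longrightarrow>
       f ((l, L), Im_sum V l L +>\<^bsub>V\<^esub> z) =
         ext_class K (trivial_alg (self_space K)) (trivial_alg V) (k_star_ext K V l L z)"
    by blast
  show "\<exists>f. bij_betw f
             (SIGMA (l, L) : T_pairs K V.
                carrier (quot_space (V\<lparr>carrier := Ker_diff V l L\<rparr>) (Im_sum V l L)))
             (Ext K (trivial_alg (self_space K)) (trivial_alg V) :: ('k, 'v, 'e, 'k) ext set set)
         \<and> (\<forall>(l, L) \<in> T_pairs K V. \<forall>z \<in> Ker_diff V l L.
              f ((l, L), Im_sum V l L +>\<^bsub>V\<^esub> z) =
                ext_class K (trivial_alg (self_space K)) (trivial_alg V)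
                  (k_star K V l L z, (\<lambda>x. (\<zero>\<^bsub>K\<^esub>, x)), fst)
              \<and> (\<forall>p \<in> carrier K. \<forall>q \<in> carrier K. \<forall>x \<in> carrier V. \<forall>y \<in> carrier V.
                   (p, x) \<otimes>\<^bsub>k_star K V l L z\<^esub> (q, y) =
                     (\<zero>\<^bsub>K\<^esub>, (p \<otimes>\<^bsub>K\<^esub> q) \<odot>\<^bsub>V\<^esub> z \<oplus>\<^bsub>V\<^esub> p \<odot>\<^bsub>V\<^esub> L y \<oplus>\<^bsub>V\<^esub> q \<odot>\<^bsub>V\<^esub> l x)))"
    by (intro exI[of _ f] conjI f(1)) (auto simp: f(2) k_star_mult)
next
  fix A :: "('k, 'b) module"
  assume "metabelian K A \<and> has_codim K A (derived_alg K A) 1"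
  then obtain W :: "('k, 'b) module" and l L z where "vectorspace K W" "(l, L) \<in> T_pairs K W"
    "z \<in> Ker_diff W l L" "alg_isomorphic K A (k_star K W l L z)"
    by (elim conjE metabelian_codim_one)
  then show "\<exists>(W :: ('k, 'b) module) l L z. vectorspace K W \<and> (l, L) \<in> T_pairs K W \<and>
      z \<in> Ker_diff W l L \<and> alg_isomorphic K A (k_star K W l L z)"
    by (intro exI conjI)
qed (rule bij_betw_scalar_datum[OF assms])

end
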